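(* Let $R$ and $M$ be finite with $R\ge\|v_b-v^*\|_2$. For any $\kappa>0$, let $N$ satisfy $N\ge(4\sigma^2M^2)/(\lambda\kappa^2)$. Then, provided that $\mathbb{E}\big[\exp\big(\sum_{i=1}^N\|\overline V^i_0-v^*\|_2^2/(N\kappa^2)\big)\big]<\infty$, it holds $$C_\kappa:=\sup_{t\in[0,T^*]}\mathbb{E}\left[\exp\left(\frac{\sum_{i=1}^N\|\overline V^i_t-v^*\|_2^2}{N\kappa^2}\right)\right]<\infty,$$ where $C_\kappa$ depends on $\kappa,\lambda,\sigma,d,R,M$ and $T^*$, and where $$d\overline V^i_t=-\lambda\big(\overline V^i_t-\mathcal{P}_{v_b,R}(v_\alpha(\rho_t))\big)dt+\sigma\big(\|\overline V^i_t-v_\alpha(\rho_t)\|_2\wedge M\big)dB^i_t$$ for $i=1,\dots,N$, with the Brownian motions $B^i$ being independent of each other and $\operatorname{Law}(\overline V^i_t)=\rho_t$.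
   Context: Standing assumptions on $f\in\mathcal{C}(\mathbb{R}^d)$: (A1) There exists $v^*\in\mathbb{R}^d$ with $f(v^* )=\inf_{v\in\mathbb{R}^d}f(v)=:\underline f$, and there exist $\underline\alpha,L_u>0$ such that $\sup_{v\in\mathbb{R}^d}\|v e^{-\alpha(f(v)-\underline f)}\|_2=:L_u<\infty$ for any $\alpha\ge\underline\alpha$. (A2) There exist $f_\infty,R_0,\nu,L_\nu>0$ such that $\|v-v^*\|_2\le\frac1{L_\nu}(f(v)-\underline f)^\nu$ for all $v\in B_{R_0}(v^* )$ and $f_\infty<f(v)-\underline f$ for all $v\notin B_{R_0}(v^* )$. (A3) There exist $L_\gamma>0$, $\gamma\in[0,1]$ such that $|f(v)-f(w)|\le L_\gamma(\|v-v^*\|_2^\gamma+\|w-v^*\|_2^\gamma)\|v-w\|_2$ for all $v,w\in\mathbb{R}^d$ and $f(v)-\underline f\le L_\gamma(1+\|v-v^*\|_2^{1+\gamma})$ for all $v\in\mathbb{R}^d$. Notation: $B_r(u)=\{v:\|v-u\|_2\le r\}$; $a\wedge b=\min\{a,b\}$. Parameters $\lambda,\sigma,\alpha,M,R>0$, $v_b\in\mathbb{R}^d$; the $B^i$ are standard Brownian motions in $\mathbb{R}^d$. $\mathcal{P}_{v_b,R}$ is the projection onto $B_R(v_b)$: $\mathcal{P}_{v_b,R}(v)=v$ if $\|v-v_b\|_2\le R$ and $v_b+R\frac{v-v_b}{\|v-v_b\|_2}$ otherwise. $\omega_\alpha(v)=\exp(-\alpha f(v))$ and $v_\alpha(\varrho)=\int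 v\,\omega_\alpha(v)\,d\varrho(v)\big/\int\omega_\alpha\,d\varrho$. The processes $\overline V^i$ are independent copies of the mean-field process started from the initial law $\rho_0$. $T^*=\frac1\lambda\log\big(2W_2^2(\rho_0,\delta_{v^*})/\epsilon\big)$ is the time horizon, for a fixed $\epsilon\in(0,W_2^2(\rho_0,\delta_{v^*}))$, with $W_2$ the Wasserstein-2 distance.
   Formalization: The bound on C_κ depends, besides κ, λ, σ, d, R, M and T*, also on the assumed-finite initial exponential moment (unavoidable, since C_κ is at least that moment); the bounding function is chosen for a fixed underlying sample set. *)

theory Defs
  imports "HOL-Probability.Probability"
begin

section \<open>Standing assumptions on the objective function\<close>

definition assumption_A1 :: "(real^'n \<Rightarrow> real) \<Rightarrow> real^'n \<Rightarrow> bool" where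
  "assumption_A1 f vstar \<longleftrightarrow>
     bdd_below (range f) \<and> f vstar = (INF v. f v) \<and>
     (\<exists>\<alpha>_low > 0. \<exists>L_u > 0. \<forall>\<alpha> \<ge> \<alpha>_low.
        (SUP v. ennreal (norm (exp (- \<alpha> * (f v - (INF w. f w))) *\<^sub>R v))) \<le> ennreal L_u)"

definition assumption_A2 :: "(real^'n \<Rightarrow> real) \<Rightarrow> real^'n \<Rightarrow> bool" where
  "assumption_A2 f vstar \<longleftrightarrow>
     (\<exists>f_inf > 0. \<exists>R\<^sub>0 > 0. \<exists>\<nu> > 0. \<exists>L_\<nu> > 0.
        (\<forall>v \<in> cball vstar R\<^sub>0. norm (v - vstar) \<le> 1 / L_\<nu> * (f v - (INF w. f w)) powr \<nu>) \<and>
        (\<forall>v. v \<notin> cball vstar R\<^sub>0 \<longrightarrow> f_inf < f v - (INF w. f w)))"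

text \<open>
  The convention \<open>0\<^sup>0 = 1\<close> is needed for the Hoelder-type exponent \<open>0\<close>;
  in the library \<open>0 powr 0 = 0\<close>.
\<close>

definition rpow :: "real \<Rightarrow> real \<Rightarrow> real" where
  "rpow x a = (if a = 0 then 1 else x powr a)"

definition assumption_A3 :: "(real^'n \<Rightarrow> real) \<Rightarrow> real^'n \<Rightarrow> bool" where
  "assumption_A3 f vstar \<longleftrightarrow>
     (\<exists>L_\<gamma> > 0. \<exists>\<gamma> \<in> {0..1}.
        (\<forall>v w. \<bar>f v - f w\<bar>
           \<le> L_\<gamma> * (rpow (norm (v - vstar)) \<gamma> + rpow (norm (w - vstar)) \<gamma>) * norm (v - w)) \<and>
        (\<forall>v. f v - (INF w. f w) \<le> L_\<gamma> * (1 + norm (v - vstar) powr (1 + \<gamma>))))"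

section \<open>Consensus point, projection, Wasserstein distance, time horizon\<close>

definition weight :: "real \<Rightarrow> (real^'n \<Rightarrow> real) \<Rightarrow> real^'n \<Rightarrow> real" where
  "weight \<alpha> f v = exp (- \<alpha> * f v)"

definition consensus_point ::
    "real \<Rightarrow> (real^'n \<Rightarrow> real) \<Rightarrow> (real^'n) measure \<Rightarrow> real^'n" where
  "consensus_point \<alpha> f \<rho> =
     (1 / (\<integral>v. weight \<alpha> f v \<partial>\<rho>)) *\<^sub>R (\<integral>v. weight \<alpha> f v *\<^sub>R v \<partial>\<rho>)"

definition proj_ball :: "real^'n \<Rightarrow> real \<Rightarrow> real^'n \<Rightarrow> real^'n" where
  "proj_ball vb R v =
     (if norm (v - vb) \<le> R then v else vb + (R / norm (v - vb)) *\<^sub>R (v - vb))"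

definition couplings ::
    "(real^'n) measure \<Rightarrow> (real^'n) measure \<Rightarrow> ((real^'n) \<times> (real^'n)) measure set" where
  "couplings \<mu> \<nu> = {\<pi>. prob_space \<pi> \<and> sets \<pi> = sets (borel \<Otimes>\<^sub>M borel) \<and>
     distr \<pi> borel fst = \<mu> \<and> distr \<pi> borel snd = \<nu>}"

definition W2 :: "(real^'n) measure \<Rightarrow> (real^'n) measure \<Rightarrow> real" where
  "W2 \<mu> \<nu> =
     sqrt (enn2real (INF \<pi> \<in> couplings \<mu> \<nu>. \<integral>\<^sup>+ z. ennreal ((norm (fst z - snd z))\<^sup>2) \<partial>\<pi>))"

definition T_star :: "real \<Rightarrow> real \<Rightarrow> (real^'n) measure \<Rightarrow> real^'n \<Rightarrow> real" where
  "T_star lam \<epsilon> \<rho>\<^sub>0 vstar = 1 / lam * ln (2 * (W2 \<rho>\<^sub>0 (return borel vstar))\<^sup>2 / \<epsilon>)"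

section \<open>Stochastic calculus\<close>

text \<open>
  Processes and filtrations are indexed by all of \<open>real\<close>; only times \<open>t \<ge> 0\<close> matter
  (a filtration on the nonnegative reals extends by \<open>F t = F 0\<close> for \<open>t < 0\<close>).
\<close>

definition filtered_prob_space :: "'a measure \<Rightarrow> (real \<Rightarrow> 'a measure) \<Rightarrow> bool" where
  "filtered_prob_space P F \<longleftrightarrow>
     prob_space P \<and> filtration (space P) F \<and> (\<forall>t. subalgebra P (F t))"

definition brownian_motion ::
    "'a measure \<Rightarrow> (real \<Rightarrow> 'a measure) \<Rightarrow> (real \<Rightarrow> 'a \<Rightarrow> real^'n) \<Rightarrow> bool" where
  "brownian_motion P F B \<longleftrightarrow>
     (\<forall>t\<ge>0. B t \<in> borel_measurable (F t)) \<and>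
     (AE \<omega> in P. B 0 \<omega> = 0) \<and>
     (AE \<omega> in P. continuous_on {0..} (\<lambda>t. B t \<omega>)) \<and>
     (\<forall>s t. 0 \<le> s \<and> s < t \<longrightarrow>
        distributed P lborel (\<lambda>\<omega>. B t \<omega> - B s \<omega>)
          (\<lambda>x. ennreal (\<Prod>j\<in>UNIV. normal_density 0 (sqrt (t - s)) (x $ j))) \<and>
        prob_space.indep_set P (sets (F s))
          (sets (vimage_algebra (space P) (\<lambda>\<omega>. B t \<omega> - B s \<omega>) borel)))"

definition progressively_measurable ::
    "(real \<Rightarrow> 'a measure) \<Rightarrow> real \<Rightarrow> (real \<Rightarrow> 'a \<Rightarrow> 'b::topological_space) \<Rightarrow> bool" where
  "progressively_measurable F T X \<longleftrightarrow>
     (\<forall>t\<in>{0..T}. (\<lambda>(s, \<omega>). X s \<omega>) \<in> borel_measurable (restrict_space borel {0..t} \<Otimes>\<^sub>M F t))"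

text \<open>
  The elementary process with partition points \<open>\<tau> 0 \<le> \<dots> \<le> \<tau> k\<close> takes the bounded,
  \<open>F (\<tau> j)\<close>-measurable value \<open>\<xi> j\<close> on \<open>(\<tau> j, \<tau> (j + 1)]\<close>.
\<close>

definition elementary ::
    "'a measure \<Rightarrow> (real \<Rightarrow> 'a measure) \<Rightarrow> nat \<Rightarrow> (nat \<Rightarrow> real) \<Rightarrow> (nat \<Rightarrow> 'a \<Rightarrow> real) \<Rightarrow> bool" where
  "elementary P F k \<tau> \<xi> \<longleftrightarrow>
     0 \<le> \<tau> 0 \<and> (\<forall>j<k. \<tau> j \<le> \<tau> (Suc j)) \<and>
     (\<forall>j<k. \<xi> j \<in> borel_measurable (F (\<tau> j)) \<and> (\<exists>K. \<forall>\<omega>\<in>space P. \<bar>\<xi> j \<omega>\<bar> \<le> K))"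

definition elem_process ::
    "nat \<Rightarrow> (nat \<Rightarrow> real) \<Rightarrow> (nat \<Rightarrow> 'a \<Rightarrow> real) \<Rightarrow> real \<Rightarrow> 'a \<Rightarrow> real" where
  "elem_process k \<tau> \<xi> s \<omega> = (\<Sum>j<k. indicator {\<tau> j <.. \<tau> (Suc j)} s * \<xi> j \<omega>)"

definition elem_integral ::
    "(real \<Rightarrow> 'a \<Rightarrow> real^'n) \<Rightarrow> nat \<Rightarrow> (nat \<Rightarrow> real) \<Rightarrow> (nat \<Rightarrow> 'a \<Rightarrow> real) \<Rightarrow> real \<Rightarrow> 'a \<Rightarrow> real^'n" where
  "elem_integral B k \<tau> \<xi> t \<omega> =
     (\<Sum>j<k. \<xi> j \<omega> *\<^sub>R (B (min t (\<tau> (Suc j))) \<omega> - B (min t (\<tau> j)) \<omega>))"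

text \<open>
  \<open>I t\<close> is the Ito integral of the scalar process \<open>H\<close> against \<open>B\<close> over \<open>[0, t]\<close>: the
  mean-square limit of the integrals of elementary processes that approximate \<open>H\<close> in mean
  square.  By the Ito isometry \<open>I t\<close> is determined almost surely, independently of the
  approximating sequence, and one exists for every progressively measurable \<open>H\<close> that is
  square integrable over \<open>[0, T] \<times> \<Omega>\<close>.
\<close>

definition has_ito_integral ::
    "'a measure \<Rightarrow> (real \<Rightarrow> 'a measure) \<Rightarrow> (real \<Rightarrow> 'a \<Rightarrow> real^'n) \<Rightarrow> real \<Rightarrow>
     (real \<Rightarrow> 'a \<Rightarrow> real) \<Rightarrow> (real \<Rightarrow> 'a \<Rightarrow> real^'n) \<Rightarrow> bool" where
  "has_ito_integral P F B T H I \<longleftrightarrow>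
     progressively_measurable F T H \<and>
     (\<forall>t\<in>{0..T}. I t \<in> borel_measurable P) \<and>
     (\<exists>k \<tau> \<xi>. (\<forall>m. elementary P F (k m) (\<tau> m) (\<xi> m)) \<and>
        (\<lambda>m::nat. \<integral>\<^sup>+ \<omega>. (\<integral>\<^sup>+ s\<in>{0..T}. ennreal ((elem_process (k m) (\<tau> m) (\<xi> m) s \<omega> - H s \<omega>)\<^sup>2)
           \<partial>lborel) \<partial>P) \<longlonglongrightarrow> 0 \<and>
        (\<forall>t\<in>{0..T}.
           (\<lambda>m. \<integral>\<^sup>+ \<omega>. ennreal ((norm (elem_integral B (k m) (\<tau> m) (\<xi> m) t \<omega> - I t \<omega>))\<^sup>2) \<partial>P)
             \<longlonglongrightarrow> 0))"

text \<open>\<open>dX = b dt + H dB\<close> on \<open>[0, T]\<close>, where the coefficients may depend on \<open>X\<close>.\<close>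

definition ito_process ::
    "'a measure \<Rightarrow> (real \<Rightarrow> 'a measure) \<Rightarrow> (real \<Rightarrow> 'a \<Rightarrow> real^'n) \<Rightarrow> real \<Rightarrow>
     (real \<Rightarrow> 'a \<Rightarrow> real^'n) \<Rightarrow> (real \<Rightarrow> 'a \<Rightarrow> real) \<Rightarrow> (real \<Rightarrow> 'a \<Rightarrow> real^'n) \<Rightarrow> bool" where
  "ito_process P F B T b H X \<longleftrightarrow>
     (\<forall>t\<in>{0..T}. X t \<in> borel_measurable (F t)) \<and>
     (AE \<omega> in P. continuous_on {0..T} (\<lambda>t. X t \<omega>)) \<and>
     progressively_measurable F T b \<and>
     (AE \<omega> in P. set_integrable lborel {0..T} (\<lambda>s. b s \<omega>)) \<and>
     (\<exists>I. has_ito_integral P F B T H I \<and>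
        (\<forall>t\<in>{0..T}. AE \<omega> in P. X t \<omega> = X 0 \<omega> + (LINT s:{0..t}|lborel. b s \<omega>) + I t \<omega>))"

definition indep_processes ::
    "'a measure \<Rightarrow> real set \<Rightarrow> nat set \<Rightarrow> (nat \<Rightarrow> real \<Rightarrow> 'a \<Rightarrow> real^'n) \<Rightarrow> bool" where
  "indep_processes P A J X \<longleftrightarrow>
     prob_space.indep_vars P (\<lambda>_. \<Pi>\<^sub>M t\<in>A. borel) (\<lambda>i \<omega>. \<lambda>t\<in>A. X i t \<omega>) J"

definition iid_processes ::
    "'a measure \<Rightarrow> real set \<Rightarrow> nat set \<Rightarrow> (nat \<Rightarrow> real \<Rightarrow> 'a \<Rightarrow> real^'n) \<Rightarrow> bool" where
  "iid_processes P A J X \<longleftrightarrow>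
     indep_processes P A J X \<and>
     (\<forall>i\<in>J. \<forall>j\<in>J. distr P (\<Pi>\<^sub>M t\<in>A. borel) (\<lambda>\<omega>. \<lambda>t\<in>A. X i t \<omega>) =
                   distr P (\<Pi>\<^sub>M t\<in>A. borel) (\<lambda>\<omega>. \<lambda>t\<in>A. X j t \<omega>))"

section \<open>The mean-field particles\<close>

definition mean_field_copies ::
    "real \<Rightarrow> real \<Rightarrow> real \<Rightarrow> real \<Rightarrow> real \<Rightarrow> (real^'n \<Rightarrow> real) \<Rightarrow> real^'n \<Rightarrow> real \<Rightarrow> nat \<Rightarrow>
     'a measure \<Rightarrow> (real \<Rightarrow> 'a measure) \<Rightarrow> (nat \<Rightarrow> real \<Rightarrow> 'a \<Rightarrow> real^'n) \<Rightarrow>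
     (real \<Rightarrow> (real^'n) measure) \<Rightarrow> (nat \<Rightarrow> real \<Rightarrow> 'a \<Rightarrow> real^'n) \<Rightarrow> bool" where
  "mean_field_copies lam \<sigma> \<alpha> R M f vb T N P F B \<rho> V \<longleftrightarrow>
     filtered_prob_space P F \<and>
     (\<forall>i\<in>{1..N}. brownian_motion P F (B i)) \<and>
     indep_processes P {0..} {1..N} B \<and>
     iid_processes P {0..T} {1..N} V \<and>
     (\<forall>i\<in>{1..N}. \<forall>t\<in>{0..T}. distr P borel (V i t) = \<rho> t) \<and>
     (\<forall>i\<in>{1..N}. ito_process P F (B i) T
        (\<lambda>t \<omega>. - lam *\<^sub>R (V i t \<omega> - proj_ball vb R (consensus_point \<alpha> f (\<rho> t))))
        (\<lambda>t \<omega>. \<sigma> * min (norm (V i t \<omega> - consensus_point \<alpha> f (\<rho> t))) M)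
        (V i))"

definition exp_moment ::
    "'a measure \<Rightarrow> nat \<Rightarrow> real \<Rightarrow> real^'n \<Rightarrow> (nat \<Rightarrow> real \<Rightarrow> 'a \<Rightarrow> real^'n) \<Rightarrow> real \<Rightarrow> ennreal" where
  "exp_moment P N \<kappa> vstar V t =
     (\<integral>\<^sup>+ \<omega>. ennreal (exp ((\<Sum>i=1..N. (norm (V i t \<omega> - vstar))\<^sup>2) / (real N * \<kappa>\<^sup>2))) \<partial>P)"

definition C_kappa ::
    "'a measure \<Rightarrow> nat \<Rightarrow> real \<Rightarrow> real^'n \<Rightarrow> (nat \<Rightarrow> real \<Rightarrow> 'a \<Rightarrow> real^'n) \<Rightarrow> real \<Rightarrow> ennreal" where
  "C_kappa P N \<kappa> vstar V T = (SUP t\<in>{0..T}. exp_moment P N \<kappa> vstar V t)"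

end

theory Submission
  imports Defs
begin

text \<open>
  No Ito formula is needed. Independence factorises the exponential moment, so one particle with the
  constant \<open>a = 1 / (N \<kappa>\<^sup>2)\<close> suffices. The exponential
  \<open>exp (\<theta> \<bullet> \<integral>\<xi> dB - |\<theta>|\<^sup>2 / 2 \<integral>\<xi>\<^sup>2 ds)\<close> of an elementary integral is a martingale, and Fatou's lemma
  makes the increments of an Ito integral with \<open>|H| \<le> h\<close> sub-Gaussian conditionally on the past. The drift
  is linear with a deterministic source, so variation of constants writes \<open>X\<^sub>t - z\<close>, with
  \<open>x = exp (- \<lambda>t)\<close>, as \<open>x (X\<^sub>0 - z) + u\<close> with \<open>u\<close> deterministic, plus a stochastic convolution, a limit of
  Riemann sums of increments with deterministic weights. The convolution is therefore sub-Gaussian with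
  variance proxy \<open>q = h\<^sup>2 (1 - x\<^sup>2) / (2 \<lambda>)\<close>. Integrating the bound on \<open>E exp (\<theta> \<bullet> (X\<^sub>t - z))\<close> against a
  Gaussian in \<open>\<theta>\<close> replaces \<open>a\<close> by \<open>a / (1 - 2 a q)\<close>. The lower bound on \<open>N\<close> gives
  \<open>2 a q \<le> (1 - x\<^sup>2) / 4\<close>, hence \<open>x / (1 - 2 a q) \<le> 1\<close>: the contraction of the initial datum absorbs the loss.
\<close>

section \<open>Gaussian integrals\<close>

text \<open>Completing the square gives a multiple of the normal density with mean
  \<open>2 * a * y\<close> and variance \<open>2 * a\<close>.\<close>

lemma nn_integral_exp_linear_minus_square:
  fixes a y :: real
  assumes "a > 0"
  shows "(\<integral>\<^sup>+x. ennreal (exp (x * y - x\<^sup>2 / (4 * a))) \<partial>lborel) = ennreal (sqrt (4 * pi * a) * exp (a * y\<^sup>2))"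
proof -
  define s where "s = sqrt (2 * a)"
  have s: "s > 0" "s\<^sup>2 = 2 * a" using assms by (auto simp: s_def)
  have eq: "exp (x * y - x\<^sup>2 / (4 * a)) = (sqrt (4 * pi * a) * exp (a * y\<^sup>2)) * normal_density (2 * a * y) s x" for x
  proof -
    have "x * y - x\<^sup>2 / (4 * a) = a * y\<^sup>2 + (- (x - 2 * a * y)\<^sup>2 / (2 * s\<^sup>2))"
      using assms unfolding s(2) by (simp add: field_simps power2_eq_square)
    moreover have "2 * pi * s\<^sup>2 = 4 * pi * a" "sqrt (4 * pi * a) \<noteq> 0"
      using assms s by simp_all
    ultimately show ?thesis
      unfolding normal_density_def by (simp only: exp_add) simp
  qed
  have "(\<integral>\<^sup>+x. ennreal (exp (x * y - x\<^sup>2 / (4 * a))) \<partial>lborel)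
      = (\<integral>\<^sup>+x. ennreal (sqrt (4 * pi * a) * exp (a * y\<^sup>2)) * ennreal (normal_density (2 * a * y) s x) \<partial>lborel)"
    unfolding eq using assms by (intro nn_integral_cong) (simp add: ennreal_mult')
  also have "\<dots> = ennreal (sqrt (4 * pi * a) * exp (a * y\<^sup>2)) * (\<integral>\<^sup>+x. ennreal (normal_density (2 * a * y) s x) \<partial>lborel)"
    by (rule nn_integral_cmult) simp
  also have "(\<integral>\<^sup>+x. ennreal (normal_density (2 * a * y) s x) \<partial>lborel) = 1"
    using s by (subst nn_integral_eq_integral) (auto simp: normal_density_nonneg)
  finally show ?thesis by simp
qed

text \<open>The integrand factorises over coordinates. Read from right to left, the identity writes
  the exponential of a square as a Gaussian superposition of exponentials of linear forms; this is
  how bounds on linear exponential moments become bounds on quadratic ones.\<close>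

lemma nn_integral_exp_inner_minus_norm_square:
  fixes y :: "'b::euclidean_space"
  assumes "a > 0"
  shows "(\<integral>\<^sup>+x. ennreal (exp (x \<bullet> y - (norm x)\<^sup>2 / (4 * a))) \<partial>lborel)
       = ennreal (sqrt (4 * pi * a) ^ DIM('b) * exp (a * (norm y)\<^sup>2))"
proof -
  have "exp (x \<bullet> y - (norm x)\<^sup>2 / (4 * a)) = (\<Prod>b\<in>Basis. exp ((x \<bullet> b) * (y \<bullet> b) - (x \<bullet> b)\<^sup>2 / (4 * a)))" for x
    using euclidean_inner[of x x] euclidean_inner[of x y]
    unfolding exp_sum[OF finite_Basis, symmetric] power2_norm_eq_inner
    by (simp add: sum_subtractf sum_divide_distrib power2_eq_square)
  then have "(\<integral>\<^sup>+x. ennreal (exp (x \<bullet> y - (norm x)\<^sup>2 / (4 * a))) \<partial>lborel)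
     = (\<integral>\<^sup>+x. (\<Prod>b\<in>Basis. ennreal (exp ((x \<bullet> b) * (y \<bullet> b) - (x \<bullet> b)\<^sup>2 / (4 * a)))) \<partial>lborel)"
    by (simp add: prod_ennreal)
  also have "\<dots> = (\<Prod>b\<in>Basis. \<integral>\<^sup>+x. ennreal (exp (x * (y \<bullet> b) - x\<^sup>2 / (4 * a))) \<partial>lborel)"
    by (rule nn_integral_lborel_prod) auto
  also have "\<dots> = (\<Prod>b\<in>Basis. ennreal (sqrt (4 * pi * a) * exp (a * (y \<bullet> b)\<^sup>2)))"
    by (simp add: nn_integral_exp_linear_minus_square[OF assms])
  also have "\<dots> = ennreal (sqrt (4 * pi * a) ^ DIM('b) * exp (\<Sum>b\<in>Basis. a * (y \<bullet> b)\<^sup>2))"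
    using assms by (simp add: prod_ennreal prod.distrib exp_sum)
  also have "(\<Sum>b\<in>Basis. a * (y \<bullet> b)\<^sup>2) = a * (norm y)\<^sup>2"
    using euclidean_inner[of y y] unfolding power2_norm_eq_inner
    by (simp add: sum_distrib_left power2_eq_square)
  finally show ?thesis .
qed

text \<open>This is the moment generating function of a centred Gaussian with covariance
  \<open>s\<^sup>2\<close> times the identity. Up to its normalising constant \<open>c\<close>, the
  density is the Gaussian factor of the preceding lemma with
  \<open>a = s\<^sup>2 / 2\<close>.\<close>

lemma nn_integral_gaussian_exp_inner:
  fixes y :: "real^'n"
  assumes "s > 0"
  shows "(\<integral>\<^sup>+x. ennreal (\<Prod>j\<in>UNIV. normal_density 0 s (x $ j)) * ennreal (exp (y \<bullet> x)) \<partial>lborel)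
       = ennreal (exp (s\<^sup>2 * (norm y)\<^sup>2 / 2))"
proof -
  define c where "c = (1 / sqrt (2 * pi * s\<^sup>2)) ^ CARD('n)"
  have "(\<Prod>j\<in>UNIV. normal_density 0 s (x $ j)) * exp (y \<bullet> x)
      = c * exp (x \<bullet> y - (norm x)\<^sup>2 / (4 * (s\<^sup>2 / 2)))" for x :: "real^'n"
  proof -
    have "(\<Prod>j\<in>UNIV. normal_density 0 s (x $ j)) = c * exp (\<Sum>j\<in>UNIV. - (x $ j)\<^sup>2 / (2 * s\<^sup>2))"
      unfolding normal_density_def prod.distrib c_def exp_sum[OF finite] by simp
    also have "(\<Sum>j\<in>UNIV. - (x $ j)\<^sup>2 / (2 * s\<^sup>2)) = - (norm x)\<^sup>2 / (2 * s\<^sup>2)"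
      unfolding power2_norm_eq_inner inner_vec_def
      by (simp add: sum_divide_distrib sum_negf power2_eq_square)
    finally show ?thesis
      by (simp add: exp_add[symmetric] inner_commute)
  qed
  then have "(\<integral>\<^sup>+x. ennreal (\<Prod>j\<in>UNIV. normal_density 0 s (x $ j)) * ennreal (exp (y \<bullet> x)) \<partial>lborel)
     = (\<integral>\<^sup>+x. ennreal c * ennreal (exp (x \<bullet> y - (norm x)\<^sup>2 / (4 * (s\<^sup>2 / 2)))) \<partial>lborel)"
    by (intro nn_integral_cong)
       (simp add: ennreal_mult'[symmetric] c_def ennreal_mult''[symmetric])
  also have "\<dots> = ennreal c * ennreal (sqrt (4 * pi * (s\<^sup>2 / 2)) ^ DIM(real^'n) * exp (s\<^sup>2 / 2 * (norm y)\<^sup>2))"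
    using assms by (subst nn_integral_cmult, simp, subst nn_integral_exp_inner_minus_norm_square) simp_all
  also have "\<dots> = ennreal (c * (sqrt (4 * pi * (s\<^sup>2 / 2)) ^ CARD('n)) * exp (s\<^sup>2 / 2 * (norm y)\<^sup>2))"
    by (subst ennreal_mult'[symmetric]) (simp_all add: c_def mult.assoc)
  also have "c * (sqrt (4 * pi * (s\<^sup>2 / 2)) ^ CARD('n)) = 1"
  proof -
    have "4 * pi * (s\<^sup>2 / 2) = 2 * pi * s\<^sup>2" by simp
    moreover have "sqrt (2 * pi * s\<^sup>2) \<noteq> 0" using assms by simp
    ultimately show ?thesis unfolding c_def by (simp only: power_one_over) simp
  qed
  finally show ?thesis by simp
qed

section \<open>Exponential martingales of elementary integrals\<close>

lemma filtered_measurable_mono: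
  assumes "filtered_prob_space P F" "s \<le> t" "f \<in> measurable (F s) N"
  shows "f \<in> measurable (F t) N"
proof (rule measurable_from_subalg[OF _ assms(3)])
  show "subalgebra (F t) (F s)"
    using assms(1,2) filtration.sets_F_mono filtration.space_F
    unfolding filtered_prob_space_def subalgebra_def by metis
qed

lemma filtered_measurable:
  assumes "filtered_prob_space P F" "f \<in> measurable (F s) N"
  shows "f \<in> measurable P N"
  using assms measurable_from_subalg unfolding filtered_prob_space_def by blast

text \<open>The increment is Gaussian and independent of \<open>F s\<close>, so once the past is
  frozen the compensator cancels its moment generating function exactly. Testing against an
  arbitrary weight \<open>W\<close> with values in \<open>ennreal\<close> expresses a conditional
  expectation equal to 1 without any integrability condition.\<close>

lemma brownian_increment_exp_martingale:
  fixes B :: "real \<Rightarrow> 'a \<Rightarrow> real^'n" and W :: "'a \<Rightarrow> ennreal" and \<xi> :: "'a \<Rightarrow> real"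
  assumes fps: "filtered_prob_space P F" and bm: "brownian_motion P F B" and st: "0 \<le> s" "s < t"
    and W: "W \<in> borel_measurable (F s)" and \<xi>: "\<xi> \<in> borel_measurable (F s)"
  shows "(\<integral>\<^sup>+\<omega>. W \<omega> * ennreal (exp (\<theta> \<bullet> (\<xi> \<omega> *\<^sub>R (B t \<omega> - B s \<omega>)) - (norm \<theta>)\<^sup>2 / 2 * ((\<xi> \<omega>)\<^sup>2 * (t - s)))) \<partial>P)
       = (\<integral>\<^sup>+\<omega>. W \<omega> \<partial>P)"
proof -
  interpret prob_space P using fps by (simp add: filtered_prob_space_def)
  define Y where "Y \<omega> = B t \<omega> - B s \<omega>" for \<omega>
  \<comment> \<open>\<open>indep_var\<close> relates variables of one type, so the past data
    \<open>(W, \<xi>)\<close> and the increment are both embedded in a common space and padded with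
    zeros.\<close>
  define S :: "((ennreal \<times> real) \<times> (real^'n)) measure" where "S = (borel \<Otimes>\<^sub>M borel) \<Otimes>\<^sub>M borel"
  define X :: "'a \<Rightarrow> (ennreal \<times> real) \<times> (real^'n)" where "X \<omega> = ((W \<omega>, \<xi> \<omega>), 0)" for \<omega>
  define Y' :: "'a \<Rightarrow> (ennreal \<times> real) \<times> (real^'n)" where "Y' \<omega> = ((0, 0), Y \<omega>)" for \<omega>
  define dens where "dens x = ennreal (\<Prod>j\<in>UNIV. normal_density 0 (sqrt (t - s)) (x $ j))" for x :: "real^'n"
  have dist: "distributed P lborel Y dens"
    and ind: "indep_set (sets (F s)) (sets (vimage_algebra (space P) Y borel))"
    using bm st unfolding brownian_motion_def Y_def[abs_def] dens_def[abs_def] by auto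
  have XF: "X \<in> F s \<rightarrow>\<^sub>M S"
    unfolding X_def[abs_def] S_def using W \<xi> by simp
  then have X[measurable]: "X \<in> P \<rightarrow>\<^sub>M S"
    by (rule filtered_measurable[OF fps])
  have Y[measurable]: "Y \<in> P \<rightarrow>\<^sub>M borel"
    using distributed_measurable[OF dist] by simp
  then have Y'[measurable]: "Y' \<in> P \<rightarrow>\<^sub>M S"
    unfolding Y'_def[abs_def] S_def by measurable
  have "Y \<in> vimage_algebra (space P) Y borel \<rightarrow>\<^sub>M borel"
    by (rule measurable_vimage_algebra1) simp
  then have YF: "Y' \<in> vimage_algebra (space P) Y borel \<rightarrow>\<^sub>M S"
    unfolding Y'_def[abs_def] S_def by measurable
  have spF: "space (F s) = space P"
    using fps by (auto simp: filtered_prob_space_def subalgebra_def)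
  \<comment> \<open>Independence of \<open>F s\<close> and of the algebra of the increment passes to
    the smaller algebras generated by \<open>X\<close> and \<open>Y'\<close>.\<close>
  have "sigma_sets (space P) {X -` A \<inter> space P | A. A \<in> sets S} \<subseteq> sets (F s)"
    using sets.sigma_sets_subset[of "{X -` A \<inter> space P | A. A \<in> sets S}" "F s"]
      measurable_sets[OF XF] unfolding spF by auto
  moreover have "sigma_sets (space P) {Y' -` A \<inter> space P | A. A \<in> sets S} \<subseteq> sets (vimage_algebra (space P) Y borel)"
    using sets.sigma_sets_subset[of "{Y' -` A \<inter> space P | A. A \<in> sets S}" "vimage_algebra (space P) Y borel"]
      measurable_sets[OF YF] unfolding space_vimage_algebra by auto
  ultimately have "indep_set (sigma_sets (space P) {X -` A \<inter> space P | A. A \<in> sets S})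
      (sigma_sets (space P) {Y' -` A \<inter> space P | A. A \<in> sets S})"
    using ind unfolding indep_set_def by (elim indep_sets_mono_sets) (auto split: bool.split)
  then have "indep_var S X S Y'"
    unfolding indep_var_eq using X Y' by simp
  then have joint: "distr P S X \<Otimes>\<^sub>M distr P S Y' = distr P (S \<Otimes>\<^sub>M S) (\<lambda>\<omega>. (X \<omega>, Y' \<omega>))"
    unfolding indep_var_distribution_eq by simp
  interpret D: prob_space "distr P S Y'" by (rule prob_space_distr) simp
  define f :: "((ennreal \<times> real) \<times> (real^'n)) \<Rightarrow> ennreal" where "f z = (case z of ((w, x), y) \<Rightarrow>
      w * ennreal (exp (\<theta> \<bullet> (x *\<^sub>R y) - (norm \<theta>)\<^sup>2 / 2 * (x\<^sup>2 * (t - s)))))" for z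
  have f[measurable]: "f \<in> borel_measurable S"
    unfolding f_def S_def by measurable
  have [measurable]: "(\<lambda>p. f (fst (fst p), snd (snd p))) \<in> borel_measurable (S \<Otimes>\<^sub>M S)"
    using f unfolding S_def by measurable
  \<comment> \<open>By independence the joint law is a product, so the increment can be integrated
    first with the past value \<open>z\<close> fixed.\<close>
  have inner: "(\<integral>\<^sup>+z'. f (fst z, snd z') \<partial>distr P S Y') = fst (fst z)" for z :: "(ennreal \<times> real) \<times> (real^'n)"
  proof -
    obtain w x v where z: "z = ((w, x), v)" by (metis prod.exhaust)
    define c where "c = ennreal (exp (- ((norm \<theta>)\<^sup>2 / 2 * (x\<^sup>2 * (t - s)))))"
    have fz: "f (fst z, y) = w * (c * ennreal (exp ((x *\<^sub>R \<theta>) \<bullet> y)))" for y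
      unfolding f_def z c_def by (simp add: ennreal_mult'[symmetric] exp_add[symmetric] algebra_simps)
    have "(\<integral>\<^sup>+z'. f (fst z, snd z') \<partial>distr P S Y') = (\<integral>\<^sup>+\<omega>. f (fst z, Y \<omega>) \<partial>P)"
    proof (subst nn_integral_distr[OF Y'])
      show "(\<lambda>z'. f (fst z, snd z')) \<in> borel_measurable (distr P S Y')"
        unfolding fz S_def by measurable
    qed (simp add: Y'_def)
    also have "\<dots> = (\<integral>\<^sup>+y. dens y * f (fst z, y) \<partial>lborel)"
      by (rule distributed_nn_integral[OF dist, symmetric]) (simp add: fz)
    also have "\<dots> = (\<integral>\<^sup>+y. (w * c) * (dens y * ennreal (exp ((x *\<^sub>R \<theta>) \<bullet> y))) \<partial>lborel)"
      by (simp add: fz ac_simps)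
    also have "\<dots> = (w * c) * (\<integral>\<^sup>+y. dens y * ennreal (exp ((x *\<^sub>R \<theta>) \<bullet> y)) \<partial>lborel)"
      using distributed_borel_measurable[OF dist] by (intro nn_integral_cmult) simp
    also have "(\<integral>\<^sup>+y. dens y * ennreal (exp ((x *\<^sub>R \<theta>) \<bullet> y)) \<partial>lborel)
        = ennreal (exp ((t - s) * (norm (x *\<^sub>R \<theta>))\<^sup>2 / 2))"
      unfolding dens_def using st by (subst nn_integral_gaussian_exp_inner) simp_all
    also have "w * c * \<dots> = w"
      unfolding c_def by (simp add: mult.assoc ennreal_mult'[symmetric] exp_add[symmetric] power_mult_distrib)
    finally show ?thesis by (simp add: z)
  qed
  have "(\<integral>\<^sup>+\<omega>. f (fst (X \<omega>), snd (Y' \<omega>)) \<partial>P)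
      = (\<integral>\<^sup>+p. f (fst (fst p), snd (snd p)) \<partial>distr P (S \<Otimes>\<^sub>M S) (\<lambda>\<omega>. (X \<omega>, Y' \<omega>)))"
    by (subst nn_integral_distr) simp_all
  also have "\<dots> = (\<integral>\<^sup>+z. \<integral>\<^sup>+z'. f (fst z, snd z') \<partial>distr P S Y' \<partial>distr P S X)"
    unfolding joint[symmetric] by (subst D.nn_integral_fst[symmetric]) simp_all
  also have "\<dots> = (\<integral>\<^sup>+z. fst (fst z) \<partial>distr P S X)"
    by (simp add: inner)
  also have "\<dots> = (\<integral>\<^sup>+\<omega>. W \<omega> \<partial>P)"
    by (subst nn_integral_distr) (simp_all add: X_def, simp add: S_def)
  finally show ?thesis by (simp add: f_def X_def Y'_def Y_def)
qed

text \<open>Clamping the partition to \<open>[s, t]\<close> keeps the coefficients adapted: an interval that survives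
  starts after the time at which its coefficient is known.\<close>

definition clamp_time :: "real \<Rightarrow> real \<Rightarrow> real \<Rightarrow> real" where
  "clamp_time s t u = max s (min t u)"

lemma clamp_time_bounds: "s \<le> t \<Longrightarrow> s \<le> clamp_time s t u \<and> clamp_time s t u \<le> t"
  by (auto simp: clamp_time_def)

lemma clamp_time_mono: "u \<le> v \<Longrightarrow> clamp_time s t u \<le> clamp_time s t v"
  by (auto simp: clamp_time_def)

text \<open>At a partition point \<open>u\<close>, the values of \<open>B\<close> stopped at
  \<open>t\<close> and at \<open>s\<close> differ by \<open>B\<close> at the clamped time minus
  \<open>B s\<close>. The term \<open>B s\<close> is common to both ends of each interval and
  cancels.\<close>

lemma elem_integral_diff:
  assumes "s \<le> t"
  shows "elem_integral B k \<tau> \<xi> t \<omega> - elem_integral B k \<tau> \<xi> s \<omega>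
     = (\<Sum>j<k. \<xi> j \<omega> *\<^sub>R (B (clamp_time s t (\<tau> (Suc j))) \<omega> - B (clamp_time s t (\<tau> j)) \<omega>))"
proof -
  have *: "B (min t u) \<omega> - B (min s u) \<omega> = B (clamp_time s t u) \<omega> - B s \<omega>" for u
    using assms by (cases "u \<le> s"; cases "u \<le> t") (auto simp: clamp_time_def min_def max_def)
  show ?thesis
    unfolding elem_integral_def sum_subtractf[symmetric] scaleR_diff_right[symmetric]
    using *[of "\<tau> (Suc j)" for j] *[of "\<tau> j" for j]
    by (intro sum.cong refl arg_cong2[where f = "(*\<^sub>R)"]) (metis (no_types, lifting) add_diff_cancel_left' diff_add_cancel diff_diff_eq2 diff_diff_add add_diff_eq)
qed

text \<open>The exponential factorises over the clamped partition intervals. Induction adds one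
  interval at a time: the factors collected so far form a new weight, known at the left end of the
  next interval, to which the one-increment identity applies.\<close>

lemma elementary_exp_martingale:
  fixes B :: "real \<Rightarrow> 'a \<Rightarrow> real^'n" and W :: "'a \<Rightarrow> ennreal"
  assumes fps: "filtered_prob_space P F" and bm: "brownian_motion P F B" and st: "0 \<le> s" "s \<le> t"
    and el: "elementary P F k \<tau> \<xi>"
    and W: "W \<in> borel_measurable (F s)"
  shows "(\<integral>\<^sup>+\<omega>. W \<omega> * ennreal (exp (\<theta> \<bullet> (elem_integral B k \<tau> \<xi> t \<omega> - elem_integral B k \<tau> \<xi> s \<omega>)
            - (norm \<theta>)\<^sup>2 / 2 * (\<Sum>j<k. (\<xi> j \<omega>)\<^sup>2 * (clamp_time s t (\<tau> (Suc j)) - clamp_time s t (\<tau> j))))) \<partial>P)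
       = (\<integral>\<^sup>+\<omega>. W \<omega> \<partial>P)"
proof -
  define r where "r j = clamp_time s t (\<tau> j)" for j
  define e where "e j \<omega> = \<theta> \<bullet> (\<xi> j \<omega> *\<^sub>R (B (r (Suc j)) \<omega> - B (r j) \<omega>))
      - (norm \<theta>)\<^sup>2 / 2 * ((\<xi> j \<omega>)\<^sup>2 * (r (Suc j) - r j))" for j \<omega>
  have rs: "s \<le> r j" "r j \<le> t" for j
    using clamp_time_bounds[OF st(2)] by (auto simp: r_def)
  have rmono: "r j \<le> r (Suc j)" if "j < k" for j
    using el that by (auto simp: r_def elementary_def intro: clamp_time_mono)
  have Bm: "B u \<in> borel_measurable (F u)" if "0 \<le> u" for u
    using bm that by (auto simp: brownian_motion_def)
  have main: "(\<lambda>\<omega>. W \<omega> * ennreal (exp (\<Sum>j<l. e j \<omega>))) \<in> borel_measurable (F (r l)) \<and>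
      (\<integral>\<^sup>+\<omega>. W \<omega> * ennreal (exp (\<Sum>j<l. e j \<omega>)) \<partial>P) = (\<integral>\<^sup>+\<omega>. W \<omega> \<partial>P)" if "l \<le> k" for l
    using that
  proof (induction l)
    case 0
    then show ?case using filtered_measurable_mono[OF fps rs(1) W] by simp
  next
    case (Suc l)
    define V where "V \<omega> = W \<omega> * ennreal (exp (\<Sum>j<l. e j \<omega>))" for \<omega>
    have V: "V \<in> borel_measurable (F (r l))" and IV: "(\<integral>\<^sup>+\<omega>. V \<omega> \<partial>P) = (\<integral>\<^sup>+\<omega>. W \<omega> \<partial>P)"
      using Suc by (simp_all add: V_def[abs_def])
    have split: "W \<omega> * ennreal (exp (\<Sum>j<Suc l. e j \<omega>)) = V \<omega> * ennreal (exp (e l \<omega>))" for \<omega>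
      by (simp add: V_def exp_add ennreal_mult' mult.assoc)
    show ?case
    \<comment> \<open>An interval collapsed by clamping contributes the factor 1. For a proper one,
      \<open>r l < r (Suc l) \<le> t\<close> forces \<open>\<tau> l < t\<close>, hence
      \<open>\<tau> l \<le> r l\<close>, and the coefficient is known in time.\<close>
    proof (cases "r l = r (Suc l)")
      case True
      then have "e l \<omega> = 0" for \<omega> by (simp add: e_def)
      then show ?thesis unfolding split using V IV True by simp
    next
      case False
      with rmono[of l] Suc.prems have lt: "r l < r (Suc l)" by simp
      then have "\<tau> l \<le> r l" using rs(2)[of "Suc l"] by (auto simp: r_def clamp_time_def)
      moreover have "\<xi> l \<in> borel_measurable (F (\<tau> l))"
        using el Suc.prems by (simp add: elementary_def)
      ultimately have xi: "\<xi> l \<in> borel_measurable (F (r l))"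
        by (rule filtered_measurable_mono[OF fps])
      have r0: "0 \<le> r l" using st rs(1)[of l] by simp
      have [measurable]: "V \<in> borel_measurable (F (r (Suc l)))" "\<xi> l \<in> borel_measurable (F (r (Suc l)))"
        "B (r l) \<in> borel_measurable (F (r (Suc l)))" "B (r (Suc l)) \<in> borel_measurable (F (r (Suc l)))"
        using V xi Bm[OF r0] Bm[of "r (Suc l)"] lt r0 filtered_measurable_mono[OF fps less_imp_le[OF lt]]
        by auto
      have "(\<lambda>\<omega>. V \<omega> * ennreal (exp (e l \<omega>))) \<in> borel_measurable (F (r (Suc l)))"
        unfolding e_def by measurable
      then show ?thesis
        unfolding split
        using brownian_increment_exp_martingale[OF fps bm r0 lt V xi, of \<theta>] IV by (simp add: e_def)
    qed
  qed
  show ?thesis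
    using main[of k] unfolding elem_integral_diff[OF st(2)] r_def[symmetric] e_def
    by (simp add: inner_sum_right sum_subtractf sum_distrib_left)
qed

section \<open>Quadratic variation of elementary integrals\<close>

lemma elem_process_eq:
  assumes "elementary P F k \<tau> \<xi>" "j < k" "x \<in> {\<tau> j<..\<tau> (Suc j)}"
  shows "elem_process k \<tau> \<xi> x \<omega> = \<xi> j \<omega>"
proof -
  have mono: "\<tau> a \<le> \<tau> b" if "a \<le> b" "b \<le> k" for a b
    using that(2,1)
  proof (induction rule: dec_induct[OF that(1)])
    case (2 n)
    have "\<tau> n \<le> \<tau> (Suc n)" using assms(1) 2 by (simp add: elementary_def)
    then show ?case using 2 by (meson Suc_leD le_trans order_trans)
  qed simp
  have "indicator {\<tau> i<..\<tau> (Suc i)} x = (0::real)" if "i < k" "i \<noteq> j" for i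
    using that assms(2,3) mono[of "Suc i" j] mono[of "Suc j" i]
    by (cases "i < j") (auto simp: indicator_def)
  then have "elem_process k \<tau> \<xi> x \<omega> = (\<Sum>i<k. if i = j then \<xi> j \<omega> else 0)"
    unfolding elem_process_def using assms(3) by (intro sum.cong) auto
  then show ?thesis using assms(2) by simp
qed

text \<open>The process is constant on each clamped interval, so the sum is the integral of its
  square over the union of these intervals, which lies in \<open>{s..t}\<close>.\<close>

lemma elementary_quadratic_variation_le:
  assumes el: "elementary P F k \<tau> \<xi>" and st: "s \<le> t"
  shows "ennreal (\<Sum>j<k. (\<xi> j \<omega>)\<^sup>2 * (clamp_time s t (\<tau> (Suc j)) - clamp_time s t (\<tau> j)))
    \<le> (\<integral>\<^sup>+x\<in>{s..t}. ennreal ((elem_process k \<tau> \<xi> x \<omega>)\<^sup>2) \<partial>lborel)"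
proof -
  define r where "r j = clamp_time s t (\<tau> j)" for j
  define g where "g x = ennreal ((elem_process k \<tau> \<xi> x \<omega>)\<^sup>2)" for x
  have [measurable]: "g \<in> borel_measurable borel"
    unfolding g_def elem_process_def by measurable
  have rmono: "r j \<le> r (Suc j)" if "j < k" for j
    using el that by (auto simp: r_def elementary_def intro: clamp_time_mono)
  have r0: "r 0 \<le> r l" if "l \<le> k" for l
    using that
  proof (induction l)
    case (Suc l)
    then show ?case using rmono[of l] by simp
  qed simp
  have rs: "s \<le> r j" "r j \<le> t" for j
    using clamp_time_bounds[OF st] by (auto simp: r_def)
  have main: "ennreal (\<Sum>j<l. (\<xi> j \<omega>)\<^sup>2 * (r (Suc j) - r j)) \<le> (\<integral>\<^sup>+x. g x * indicator {r 0<..r l} x \<partial>lborel)"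
    if "l \<le> k" for l
    using that
  proof (induction l)
    case (Suc l)
    have "ennreal ((\<xi> l \<omega>)\<^sup>2 * (r (Suc l) - r l)) = (\<integral>\<^sup>+x. ennreal ((\<xi> l \<omega>)\<^sup>2) * indicator {r l<..r (Suc l)} x \<partial>lborel)"
      using rmono[of l] Suc.prems by (simp add: nn_integral_cmult_indicator ennreal_mult')
    also have "\<dots> = (\<integral>\<^sup>+x. g x * indicator {r l<..r (Suc l)} x \<partial>lborel)"
    proof (rule nn_integral_cong)
      fix x
      show "ennreal ((\<xi> l \<omega>)\<^sup>2) * indicator {r l<..r (Suc l)} x = g x * indicator {r l<..r (Suc l)} x"
      proof (cases "x \<in> {r l<..r (Suc l)}")
        case True
        then have "x \<in> {\<tau> l<..\<tau> (Suc l)}"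
          using rs(1)[of l] rs(2)[of "Suc l"] by (auto simp: r_def clamp_time_def)
        then show ?thesis using elem_process_eq[OF el, of l x] Suc.prems by (simp add: g_def)
      qed simp
    qed
    finally have step: "ennreal ((\<xi> l \<omega>)\<^sup>2 * (r (Suc l) - r l)) = \<dots>" .
    have "ennreal (\<Sum>j<Suc l. (\<xi> j \<omega>)\<^sup>2 * (r (Suc j) - r j))
        = ennreal (\<Sum>j<l. (\<xi> j \<omega>)\<^sup>2 * (r (Suc j) - r j)) + ennreal ((\<xi> l \<omega>)\<^sup>2 * (r (Suc l) - r l))"
      using rmono Suc.prems by (subst ennreal_plus[symmetric]) (auto intro!: sum_nonneg)
    also have "\<dots> \<le> (\<integral>\<^sup>+x. g x * indicator {r 0<..r l} x \<partial>lborel) + (\<integral>\<^sup>+x. g x * indicator {r l<..r (Suc l)} x \<partial>lborel)"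
      unfolding step using Suc by (intro add_mono) auto
    also have "\<dots> = (\<integral>\<^sup>+x. g x * indicator {r 0<..r l} x + g x * indicator {r l<..r (Suc l)} x \<partial>lborel)"
      by (rule nn_integral_add[symmetric]) measurable
    also have "\<dots> = (\<integral>\<^sup>+x. g x * indicator {r 0<..r (Suc l)} x \<partial>lborel)"
      using rmono[of l] r0[of l] Suc.prems by (intro nn_integral_cong) (auto simp: indicator_def)
    finally show ?case .
  qed simp
  have "(\<integral>\<^sup>+x. g x * indicator {r 0<..r k} x \<partial>lborel) \<le> (\<integral>\<^sup>+x. g x * indicator {s..t} x \<partial>lborel)"
    using rs(1)[of 0] rs(2)[of k] by (intro nn_integral_mono) (auto simp: indicator_def)
  with main[of k] show ?thesis by (simp add: r_def g_def)
qed

section \<open>Ito integrals of bounded processes\<close>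

text \<open>Indices with integrals below \<open>(1 / 2) ^ n\<close> make the sum of the chosen
  functions integrable, hence finite almost everywhere, so its terms vanish in the limit. The
  sequence \<open>r\<close> only selects indices; it is not claimed to increase.\<close>

lemma nn_integral_tendsto_0_AE_subseq:
  fixes f :: "nat \<Rightarrow> 'a \<Rightarrow> ennreal"
  assumes f[measurable]: "\<And>n. f n \<in> borel_measurable M"
    and lim: "(\<lambda>n. \<integral>\<^sup>+x. f n x \<partial>M) \<longlonglongrightarrow> 0"
  shows "\<exists>r. AE x in M. (\<lambda>n. f (r n) x) \<longlonglongrightarrow> 0"
proof -
  have "\<exists>m. (\<integral>\<^sup>+x. f m x \<partial>M) < ennreal ((1 / 2) ^ n)" for n
    using order_tendstoD(2)[OF lim, of "ennreal ((1 / 2) ^ n)"] by (auto simp: eventually_sequentially)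
  then obtain r where r: "(\<integral>\<^sup>+x. f (r n) x \<partial>M) < ennreal ((1 / 2) ^ n)" for n by metis
  have "(\<integral>\<^sup>+x. (\<Sum>n. f (r n) x) \<partial>M) = (\<Sum>n. \<integral>\<^sup>+x. f (r n) x \<partial>M)"
    by (rule nn_integral_suminf) simp
  also have "\<dots> \<le> (\<Sum>n. ennreal ((1 / 2) ^ n))"
    by (intro suminf_le less_imp_le[OF r]) auto
  also have "\<dots> < \<top>"
    by (subst suminf_ennreal2) (auto intro: summable_geometric)
  finally have "AE x in M. (\<Sum>n. f (r n) x) \<noteq> \<infinity>"
    by (intro nn_integral_noteq_infinite) auto
  then have "AE x in M. (\<lambda>n. f (r n) x) \<longlonglongrightarrow> 0"
  proof eventually_elim
    case (elim x)
    then have fin: "f (r n) x \<noteq> \<top>" for n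
      using ennreal_suminf_lessD[of "\<lambda>n. f (r n) x" \<top> n] elim by (auto simp: less_top)
    have "summable (\<lambda>n. enn2real (f (r n) x))"
      using elim fin by (intro summable_suminf_not_top) (auto simp: less_top)
    then have "(\<lambda>n. ennreal (enn2real (f (r n) x))) \<longlonglongrightarrow> ennreal 0"
      by (intro tendsto_ennrealI summable_LIMSEQ_zero)
    then show ?case using fin by (simp add: less_top)
  qed
  then show ?thesis by blast
qed

text \<open>A form of Young's inequality. It exchanges an approximating process for its limit at the
  price of a factor \<open>1 + \<eta>\<close> close to 1 and a multiple of the squared
  error.\<close>

lemma power2_le_perturb:
  fixes x y \<eta> :: real
  assumes "\<eta> > 0"
  shows "x\<^sup>2 \<le> (1 + \<eta>) * y\<^sup>2 + (1 + 1 / \<eta>) * (x - y)\<^sup>2"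
proof -
  have "0 \<le> (\<eta> * y - (x - y))\<^sup>2 / \<eta>" using assms by simp
  also have "\<dots> = (1 + \<eta>) * y\<^sup>2 + (1 + 1 / \<eta>) * (x - y)\<^sup>2 - x\<^sup>2"
    using assms by (simp add: field_simps power2_eq_square)
  finally show ?thesis by simp
qed

section \<open>Conditional sub-Gaussian bound for increments of the Ito integral\<close>

lemma progressively_measurable_lborel:
  assumes "filtered_prob_space P F" "progressively_measurable F T H" "0 \<le> t" "t \<le> T"
  shows "(\<lambda>(\<omega>, s). H s \<omega>) \<in> borel_measurable (F t \<Otimes>\<^sub>M restrict_space lborel {0..t})"
proof -
  have "(\<lambda>(s, \<omega>). H s \<omega>) \<in> borel_measurable (restrict_space borel {0..t} \<Otimes>\<^sub>M F t)"
    using assms by (auto simp: progressively_measurable_def)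
  also have "borel_measurable (restrict_space borel {0..t} \<Otimes>\<^sub>M F t)
      = borel_measurable (restrict_space lborel {0..t} \<Otimes>\<^sub>M F t)"
    by (intro measurable_cong_sets sets_pair_measure_cong sets_restrict_space_cong) auto
  finally show ?thesis
    using measurable_pair_swap[of "\<lambda>(s, \<omega>). H s \<omega>"] by simp
qed

text \<open>Elementary approximants satisfy an exact exponential identity, but need not respect the
  bound \<open>h\<close>. Their quadratic variation over \<open>{s..t}\<close> is at most
  \<open>(1 + \<eta>) * h\<^sup>2 * (t - s)\<close> plus a multiple of the mean-square error along
  the path, which vanishes almost surely along selected indices. Fatou's lemma and then \<eta>
  tending to 0 give the bound.\<close>

lemma ito_increment_exp_bound:
  fixes B I :: "real \<Rightarrow> 'a \<Rightarrow> real^'n" and W :: "'a \<Rightarrow> ennreal"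
  assumes fps: "filtered_prob_space P F" and bm: "brownian_motion P F B"
    and ito: "has_ito_integral P F B T H I" and st: "0 \<le> s" "s \<le> t" "t \<le> T"
    and Hh: "\<And>u \<omega>. u \<in> {0..T} \<Longrightarrow> \<omega> \<in> space P \<Longrightarrow> \<bar>H u \<omega>\<bar> \<le> h"
    and W: "W \<in> borel_measurable (F s)"
  shows "(\<integral>\<^sup>+\<omega>. W \<omega> * ennreal (exp (\<theta> \<bullet> (I t \<omega> - I s \<omega>))) \<partial>P)
       \<le> ennreal (exp ((norm \<theta>)\<^sup>2 / 2 * (h\<^sup>2 * (t - s)))) * (\<integral>\<^sup>+\<omega>. W \<omega> \<partial>P)"
proof -
  define R where "R = restrict_space lborel {0..T}"
  have T0: "0 \<le> T" using st by simp
  interpret R: sigma_finite_measure R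
    unfolding R_def by (rule sigma_finite_measure_restrict_space) (auto intro: lborel.sigma_finite_measure_axioms)
  obtain k \<tau> \<xi> where el: "\<And>m. elementary P F (k m) (\<tau> m) (\<xi> m)"
    and lim0: "(\<lambda>m. \<integral>\<^sup>+ \<omega>. (\<integral>\<^sup>+ u\<in>{0..T}. ennreal ((elem_process (k m) (\<tau> m) (\<xi> m) u \<omega> - H u \<omega>)\<^sup>2)
           \<partial>lborel) \<partial>P) \<longlonglongrightarrow> 0"
    and limI: "\<And>t. t \<in> {0..T} \<Longrightarrow>
           (\<lambda>m. \<integral>\<^sup>+ \<omega>. ennreal ((norm (elem_integral B (k m) (\<tau> m) (\<xi> m) t \<omega> - I t \<omega>))\<^sup>2) \<partial>P) \<longlonglongrightarrow> 0"
    using ito unfolding has_ito_integral_def by blast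
  define e where "e m u \<omega> = elem_process (k m) (\<tau> m) (\<xi> m) u \<omega>" for m u \<omega>
  define J where "J m u \<omega> = elem_integral B (k m) (\<tau> m) (\<xi> m) u \<omega>" for m u \<omega>
  define D where "D m \<omega> = (\<integral>\<^sup>+u. ennreal ((e m u \<omega> - H u \<omega>)\<^sup>2) \<partial>R)" for m \<omega>
  have D_eq: "D m \<omega> = (\<integral>\<^sup>+ u\<in>{0..T}. ennreal ((elem_process (k m) (\<tau> m) (\<xi> m) u \<omega> - H u \<omega>)\<^sup>2) \<partial>lborel)" for m \<omega>
    unfolding D_def R_def e_def by (subst nn_integral_restrict_space) auto
  have H_F: "(\<lambda>(\<omega>, u). H u \<omega>) \<in> borel_measurable (F T \<Otimes>\<^sub>M R)"
    using progressively_measurable_lborel[OF fps _ T0, of T H] ito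
    unfolding R_def has_ito_integral_def by simp
  have id: "(\<lambda>\<omega>. \<omega>) \<in> P \<rightarrow>\<^sub>M F T"
    by (rule filtered_measurable[OF fps, of _ T]) simp
  have H_P[measurable]: "(\<lambda>(\<omega>, u). H u \<omega>) \<in> borel_measurable (P \<Otimes>\<^sub>M R)"
    using measurable_compose[OF measurable_Pair[OF measurable_compose[OF measurable_fst id] measurable_snd] H_F]
    by (simp add: split_beta')
  have xi[measurable]: "\<xi> m j \<in> borel_measurable P" if "j < k m" for m j
    using el[of m] that filtered_measurable[OF fps, of "\<xi> m j" "\<tau> m j"] by (auto simp: elementary_def)
  have uR[measurable]: "(\<lambda>u. u) \<in> R \<rightarrow>\<^sub>M borel"
    unfolding R_def by (rule measurable_restrict_space1) simp
  have e_P[measurable]: "(\<lambda>(\<omega>, u). e m u \<omega>) \<in> borel_measurable (P \<Otimes>\<^sub>M R)" for m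
  proof -
    have "(\<lambda>p. indicator {\<tau> m j<..\<tau> m (Suc j)} (snd p) * \<xi> m j (fst p)) \<in> borel_measurable (P \<Otimes>\<^sub>M R)" if "j < k m" for j
      using xi[OF that] measurable_compose[OF measurable_snd uR, of P] by measurable
    then show ?thesis unfolding e_def elem_process_def split_beta' by (intro borel_measurable_sum) auto
  qed
  have D_P[measurable]: "D m \<in> borel_measurable P" for m
    unfolding D_def[abs_def] by measurable
  have B_P[measurable]: "B u \<in> borel_measurable P" if "0 \<le> u" for u
    using bm that filtered_measurable[OF fps] by (auto simp: brownian_motion_def)
  have tau: "0 \<le> \<tau> m j" if "j \<le> k m" for m j
    using that
  proof (induction j)
    case (Suc j)
    moreover have "\<tau> m j \<le> \<tau> m (Suc j)" using el[of m] Suc.prems by (simp add: elementary_def)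
    ultimately show ?case by simp
  qed (use el[of m] in \<open>simp add: elementary_def\<close>)
  have J_P[measurable]: "J m u \<in> borel_measurable P" if "0 \<le> u" for m u
    unfolding J_def[abs_def] elem_integral_def
    using that tau[of _ m] by (intro borel_measurable_sum borel_measurable_scaleR borel_measurable_diff xi B_P) auto
  have I_P[measurable]: "I u \<in> borel_measurable P" if "u \<in> {0..T}" for u
    using ito that by (simp add: has_ito_integral_def)
  have [measurable]: "I t \<in> borel_measurable P" "I s \<in> borel_measurable P"
    "J m t \<in> borel_measurable P" "J m s \<in> borel_measurable P" for m
    using st by (auto intro: I_P J_P)
  \<comment> \<open>Adding the three errors lets one selection of indices make all of them vanish
    almost surely.\<close>
  define E where "E m \<omega> = D m \<omega> + ennreal ((norm (J m t \<omega> - I t \<omega>))\<^sup>2) + ennreal ((norm (J m s \<omega> - I s \<omega>))\<^sup>2)" for m \<omega>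
  have "(\<integral>\<^sup>+\<omega>. E m \<omega> \<partial>P) = (\<integral>\<^sup>+\<omega>. D m \<omega> \<partial>P) + (\<integral>\<^sup>+\<omega>. ennreal ((norm (J m t \<omega> - I t \<omega>))\<^sup>2) \<partial>P)
      + (\<integral>\<^sup>+\<omega>. ennreal ((norm (J m s \<omega> - I s \<omega>))\<^sup>2) \<partial>P)" for m
    unfolding E_def by (simp add: nn_integral_add)
  moreover have "(\<lambda>m. (\<integral>\<^sup>+\<omega>. D m \<omega> \<partial>P) + (\<integral>\<^sup>+\<omega>. ennreal ((norm (J m t \<omega> - I t \<omega>))\<^sup>2) \<partial>P)
      + (\<integral>\<^sup>+\<omega>. ennreal ((norm (J m s \<omega> - I s \<omega>))\<^sup>2) \<partial>P)) \<longlonglongrightarrow> 0 + 0 + 0"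
    unfolding D_eq J_def using st by (intro tendsto_add lim0 limI) auto
  ultimately have "(\<lambda>m. \<integral>\<^sup>+\<omega>. E m \<omega> \<partial>P) \<longlonglongrightarrow> 0" by simp
  moreover have "E m \<in> borel_measurable P" for m
    unfolding E_def[abs_def] by measurable
  ultimately obtain r where r: "AE \<omega> in P. (\<lambda>n. E (r n) \<omega>) \<longlonglongrightarrow> 0"
    using nn_integral_tendsto_0_AE_subseq[of E P] by blast
  define Q where "Q m \<omega> = (\<Sum>j<k m. (\<xi> m j \<omega>)\<^sup>2 * (clamp_time s t (\<tau> m (Suc j)) - clamp_time s t (\<tau> m j)))" for m \<omega>
  define Z where "Z m \<omega> = W \<omega> * ennreal (exp (\<theta> \<bullet> (J m t \<omega> - J m s \<omega>) - (norm \<theta>)\<^sup>2 / 2 * Q m \<omega>))" for m \<omega>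
  have Z_int: "(\<integral>\<^sup>+\<omega>. Z m \<omega> \<partial>P) = (\<integral>\<^sup>+\<omega>. W \<omega> \<partial>P)" for m
    unfolding Z_def J_def Q_def using elementary_exp_martingale[OF fps bm st(1,2) el W] .
  have W_P[measurable]: "W \<in> borel_measurable P" by (rule filtered_measurable[OF fps W])
  have [measurable]: "Q m \<in> borel_measurable P" for m
    unfolding Q_def[abs_def] by (intro borel_measurable_sum borel_measurable_times borel_measurable_power xi) auto
  have Z_P[measurable]: "Z m \<in> borel_measurable P" for m
    unfolding Z_def[abs_def] by measurable
  have bound: "(\<integral>\<^sup>+\<omega>. W \<omega> * ennreal (exp (\<theta> \<bullet> (I t \<omega> - I s \<omega>))) \<partial>P)
       \<le> ennreal (exp ((norm \<theta>)\<^sup>2 / 2 * ((1 + \<eta>) * h\<^sup>2 * (t - s)))) * (\<integral>\<^sup>+\<omega>. W \<omega> \<partial>P)" if \<eta>: "\<eta> > 0" for \<eta>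
  proof -
    define b where "b = (1 + \<eta>) * h\<^sup>2 * (t - s)"
    have b0: "0 \<le> b" using \<eta> st by (simp add: b_def)
    define c where "c = 1 + 1 / \<eta>"
    have c0: "0 \<le> c" using \<eta> by (simp add: c_def)
    \<comment> \<open>The squared approximant is split into the limit \<open>H\<close>, bounded by
      \<open>h\<close>, and the error; the error is integrated over all of \<open>{0..T}\<close>,
      where it equals \<open>D m \<omega>\<close>.\<close>
    have Q_le: "ennreal (Q m \<omega>) \<le> ennreal b + ennreal c * D m \<omega>" if \<omega>: "\<omega> \<in> space P" for m \<omega>
    proof -
      have [measurable]: "(\<lambda>u. H u \<omega>) \<in> borel_measurable R" "(\<lambda>u. e m u \<omega>) \<in> borel_measurable R"
        using measurable_compose[OF measurable_Pair1'[OF \<omega>] H_P] measurable_compose[OF measurable_Pair1'[OF \<omega>] e_P]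
        by simp_all
      have [measurable]: "{s..t} \<inter> space R \<in> sets R"
        unfolding R_def by (auto simp: sets_restrict_space space_restrict_space)
      have ind[measurable]: "(indicator {s..t} :: real \<Rightarrow> ennreal) \<in> borel_measurable R"
        by (rule measurable_compose[OF uR]) simp
      have "ennreal (Q m \<omega>) \<le> (\<integral>\<^sup>+u\<in>{s..t}. ennreal ((e m u \<omega>)\<^sup>2) \<partial>lborel)"
        unfolding Q_def e_def by (rule elementary_quadratic_variation_le[OF el st(2)])
      also have "\<dots> = (\<integral>\<^sup>+u. ennreal ((e m u \<omega>)\<^sup>2) * indicator {s..t} u \<partial>R)"
        unfolding R_def using st by (subst nn_integral_restrict_space) (auto intro!: nn_integral_cong simp: indicator_def)
      also have "\<dots> \<le> (\<integral>\<^sup>+u. ennreal ((1 + \<eta>) * h\<^sup>2) * indicator {s..t} u + ennreal c * ennreal ((e m u \<omega> - H u \<omega>)\<^sup>2) \<partial>R)"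
      proof (rule nn_integral_mono)
        fix u assume "u \<in> space R"
        then have u: "u \<in> {0..T}" by (simp add: R_def space_restrict_space)
        have "(e m u \<omega>)\<^sup>2 \<le> (1 + \<eta>) * (H u \<omega>)\<^sup>2 + c * (e m u \<omega> - H u \<omega>)\<^sup>2"
          unfolding c_def by (rule power2_le_perturb[OF \<eta>])
        also have "(H u \<omega>)\<^sup>2 \<le> h\<^sup>2" using Hh[OF u \<omega>] by (simp add: abs_le_square_iff[symmetric])
        finally have "(e m u \<omega>)\<^sup>2 \<le> (1 + \<eta>) * h\<^sup>2 + c * (e m u \<omega> - H u \<omega>)\<^sup>2"
          using \<eta> by simp
        then have "ennreal ((e m u \<omega>)\<^sup>2) \<le> ennreal ((1 + \<eta>) * h\<^sup>2) + ennreal c * ennreal ((e m u \<omega> - H u \<omega>)\<^sup>2)"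
          using \<eta> c0 by (simp add: ennreal_mult'[symmetric] ennreal_plus[symmetric] del: ennreal_plus)
        then show "ennreal ((e m u \<omega>)\<^sup>2) * indicator {s..t} u
          \<le> ennreal ((1 + \<eta>) * h\<^sup>2) * indicator {s..t} u + ennreal c * ennreal ((e m u \<omega> - H u \<omega>)\<^sup>2)"
          by (auto simp: indicator_def)
      qed
      also have "\<dots> = (\<integral>\<^sup>+u. ennreal ((1 + \<eta>) * h\<^sup>2) * indicator {s..t} u \<partial>R) + ennreal c * D m \<omega>"
        unfolding D_def by (subst nn_integral_add) (simp_all add: nn_integral_cmult)
      also have "(\<integral>\<^sup>+u. ennreal ((1 + \<eta>) * h\<^sup>2) * indicator {s..t} u \<partial>R)
          = (\<integral>\<^sup>+u. ennreal ((1 + \<eta>) * h\<^sup>2) * indicator {s..t} u \<partial>lborel)"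
        unfolding R_def using st by (subst nn_integral_restrict_space) (auto intro!: nn_integral_cong simp: indicator_def)
      also have "\<dots> = ennreal b"
        using st \<eta> by (simp add: nn_integral_cmult_indicator b_def ennreal_mult')
      finally show ?thesis .
    qed
    define G where "G \<omega> = W \<omega> * ennreal (exp (\<theta> \<bullet> (I t \<omega> - I s \<omega>) - (norm \<theta>)\<^sup>2 / 2 * b))" for \<omega>
    have "AE \<omega> in P. G \<omega> \<le> liminf (\<lambda>n. Z (r n) \<omega>)"
      using r AE_space
    proof eventually_elim
      case (elim \<omega>)
      have comp: "(\<lambda>n. a n) \<longlonglongrightarrow> 0" if "\<And>n. a n \<le> E (r n) \<omega>" for a :: "nat \<Rightarrow> ennreal"
        using elim(1) that by (intro tendsto_sandwich[of "\<lambda>_. 0" a sequentially "\<lambda>n. E (r n) \<omega>"]) auto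
      have D0: "(\<lambda>n. D (r n) \<omega>) \<longlonglongrightarrow> 0"
        by (rule comp) (simp add: E_def add.assoc)
      have J0: "(\<lambda>n. ennreal ((norm (J (r n) v \<omega> - I v \<omega>))\<^sup>2)) \<longlonglongrightarrow> 0" if "v = s \<or> v = t" for v
        using that by (intro comp) (auto simp: E_def add.assoc add.left_commute intro: add_increasing add_increasing2)
      have J1: "(\<lambda>n. J (r n) v \<omega>) \<longlonglongrightarrow> I v \<omega>" if "v = s \<or> v = t" for v
      proof -
        have "(\<lambda>n. (norm (J (r n) v \<omega> - I v \<omega>))\<^sup>2) \<longlonglongrightarrow> 0"
          using tendsto_enn2real[of "\<lambda>n. ennreal ((norm (J (r n) v \<omega> - I v \<omega>))\<^sup>2)" 0 sequentially] J0[OF that] by simp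
        then have "(\<lambda>n. sqrt ((norm (J (r n) v \<omega> - I v \<omega>))\<^sup>2)) \<longlonglongrightarrow> sqrt 0" by (rule tendsto_real_sqrt)
        then show ?thesis by (simp add: tendsto_norm_zero_iff LIM_zero_iff)
      qed
      \<comment> \<open>\<open>enn2real\<close> sends infinity to 0, so \<open>d n\<close>
        represents the error only where that is finite; \<open>fin\<close> ensures this for all
        large \<open>n\<close>.\<close>
      define d where "d n = enn2real (D (r n) \<omega>)" for n
      have d0: "d \<longlonglongrightarrow> 0"
        using tendsto_enn2real[of "\<lambda>n. D (r n) \<omega>" 0 sequentially] D0 unfolding d_def[abs_def] by simp
      have fin: "eventually (\<lambda>n. D (r n) \<omega> < \<top>) sequentially"
        using order_tendstoD(2)[OF D0, of \<top>] by simp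
      define L where "L n = W \<omega> * ennreal (exp (\<theta> \<bullet> (J (r n) t \<omega> - J (r n) s \<omega>) - (norm \<theta>)\<^sup>2 / 2 * (b + c * d n)))" for n
      have "(\<lambda>n. exp (\<theta> \<bullet> (J (r n) t \<omega> - J (r n) s \<omega>) - (norm \<theta>)\<^sup>2 / 2 * (b + c * d n)))
          \<longlonglongrightarrow> exp (\<theta> \<bullet> (I t \<omega> - I s \<omega>) - (norm \<theta>)\<^sup>2 / 2 * (b + c * 0))"
        by (intro tendsto_intros J1 d0) auto
      then have "L \<longlonglongrightarrow> G \<omega>"
        unfolding L_def[abs_def] G_def by (intro tendsto_mult_ennreal tendsto_const tendsto_ennrealI) auto
      then have "G \<omega> = liminf L" by (simp add: lim_imp_Liminf)
      also have "\<dots> \<le> liminf (\<lambda>n. Z (r n) \<omega>)"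
      proof (rule Liminf_mono)
        show "\<forall>\<^sub>F n in sequentially. L n \<le> Z (r n) \<omega>"
          using fin
        proof eventually_elim
          case (elim n)
          then have D_d: "D (r n) \<omega> = ennreal (d n)" "0 \<le> d n" by (simp_all add: d_def)
          have "ennreal (Q (r n) \<omega>) \<le> ennreal b + ennreal c * ennreal (d n)"
            using Q_le[OF \<open>\<omega> \<in> space P\<close>, of "r n"] unfolding D_d(1) .
          also have "\<dots> = ennreal (b + c * d n)"
            using b0 c0 D_d(2) by (simp add: ennreal_mult')
          finally have "Q (r n) \<omega> \<le> b + c * d n"
            using b0 c0 D_d(2) by (subst (asm) ennreal_le_iff) auto
          then show ?case
            unfolding L_def Z_def by (intro mult_left_mono ennreal_leI) (auto intro!: mult_left_mono)
        qed
      qed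
      finally show ?case .
    qed
    then have "(\<integral>\<^sup>+\<omega>. G \<omega> \<partial>P) \<le> (\<integral>\<^sup>+\<omega>. liminf (\<lambda>n. Z (r n) \<omega>) \<partial>P)"
      by (rule nn_integral_mono_AE)
    also have "\<dots> \<le> liminf (\<lambda>n. \<integral>\<^sup>+\<omega>. Z (r n) \<omega> \<partial>P)"
      by (rule nn_integral_liminf) simp
    also have "\<dots> = (\<integral>\<^sup>+\<omega>. W \<omega> \<partial>P)"
      by (simp add: Z_int Liminf_const)
    finally have G_le: "(\<integral>\<^sup>+\<omega>. G \<omega> \<partial>P) \<le> (\<integral>\<^sup>+\<omega>. W \<omega> \<partial>P)" .
    have G_P: "G \<in> borel_measurable P" unfolding G_def[abs_def] by measurable
    have "(\<integral>\<^sup>+\<omega>. W \<omega> * ennreal (exp (\<theta> \<bullet> (I t \<omega> - I s \<omega>))) \<partial>P) = (\<integral>\<^sup>+\<omega>. ennreal (exp ((norm \<theta>)\<^sup>2 / 2 * b)) * G \<omega> \<partial>P)"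
    proof (rule nn_integral_cong)
      fix \<omega>
      have "ennreal (exp (\<theta> \<bullet> (I t \<omega> - I s \<omega>)))
          = ennreal (exp ((norm \<theta>)\<^sup>2 / 2 * b)) * ennreal (exp (\<theta> \<bullet> (I t \<omega> - I s \<omega>) - (norm \<theta>)\<^sup>2 / 2 * b))"
        by (simp add: ennreal_mult'[symmetric] exp_add[symmetric])
      then show "W \<omega> * ennreal (exp (\<theta> \<bullet> (I t \<omega> - I s \<omega>))) = ennreal (exp ((norm \<theta>)\<^sup>2 / 2 * b)) * G \<omega>"
        unfolding G_def by (simp only: ac_simps)
    qed
    also have "\<dots> = ennreal (exp ((norm \<theta>)\<^sup>2 / 2 * b)) * (\<integral>\<^sup>+\<omega>. G \<omega> \<partial>P)"
      by (rule nn_integral_cmult[OF G_P])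
    also have "\<dots> \<le> ennreal (exp ((norm \<theta>)\<^sup>2 / 2 * b)) * (\<integral>\<^sup>+\<omega>. W \<omega> \<partial>P)"
      by (intro mult_left_mono G_le) simp
    finally show ?thesis by (simp add: b_def)
  qed
  \<comment> \<open>The left side of \<open>bound\<close> is free of \<eta>, so it stays below the
    limit of the right side at 0 from the right.\<close>
  have "((\<lambda>\<eta>. ennreal (exp ((norm \<theta>)\<^sup>2 / 2 * ((1 + \<eta>) * h\<^sup>2 * (t - s)))) * (\<integral>\<^sup>+\<omega>. W \<omega> \<partial>P))
      \<longlongrightarrow> ennreal (exp ((norm \<theta>)\<^sup>2 / 2 * ((1 + 0) * h\<^sup>2 * (t - s)))) * (\<integral>\<^sup>+\<omega>. W \<omega> \<partial>P)) (at_right 0)"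
    by (intro tendsto_mult_ennreal tendsto_const tendsto_ennrealI tendsto_intros) auto
  then have "(\<integral>\<^sup>+\<omega>. W \<omega> * ennreal (exp (\<theta> \<bullet> (I t \<omega> - I s \<omega>))) \<partial>P)
      \<le> ennreal (exp ((norm \<theta>)\<^sup>2 / 2 * ((1 + 0) * h\<^sup>2 * (t - s)))) * (\<integral>\<^sup>+\<omega>. W \<omega> \<partial>P)"
  proof (rule tendsto_lowerbound)
    show "\<forall>\<^sub>F \<eta> in at_right 0. (\<integral>\<^sup>+\<omega>. W \<omega> * ennreal (exp (\<theta> \<bullet> (I t \<omega> - I s \<omega>))) \<partial>P)
       \<le> ennreal (exp ((norm \<theta>)\<^sup>2 / 2 * ((1 + \<eta>) * h\<^sup>2 * (t - s)))) * (\<integral>\<^sup>+\<omega>. W \<omega> \<partial>P)"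
      using eventually_at_right_less[of "0::real"] by eventually_elim (rule bound)
  qed simp
  then show ?thesis by simp
qed

section \<open>Processes with linear drift\<close>

text \<open>Formally \<open>dG = dy + lam (y - p) ds\<close>, and \<open>c\<close> has derivative
  \<open>lam * c\<close>, so \<open>c dG = d(c y) - lam c p ds\<close>. In the application
  \<open>G\<close> is a rough path of a stochastic integral, so integration against it is replaced
  by left-endpoint sums, whose limit is explicit.\<close>

lemma variation_of_constants_riemann_sum:
  fixes y p G :: "real \<Rightarrow> 'b::euclidean_space"
  assumes t: "0 \<le> t" and lam: "0 < lam"
    and y: "continuous_on {0..t} y" and p: "set_integrable lborel {0..t} p"
    and pC: "\<And>s. s \<in> {0..t} \<Longrightarrow> norm (p s) \<le> C"
    and G: "\<And>s. s \<in> {0..t} \<Longrightarrow> G s = y s - y 0 + lam *\<^sub>R integral {0..s} (\<lambda>r. y r - p r)"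
    and c: "\<And>s. c s = exp (- lam * (t - s))"
  shows "(\<lambda>n. \<Sum>k<n. c (real k * (t / real n)) *\<^sub>R (G (real (Suc k) * (t / real n)) - G (real k * (t / real n))))
      \<longlonglongrightarrow> y t - c 0 *\<^sub>R y 0 - lam *\<^sub>R integral {0..t} (\<lambda>s. c s *\<^sub>R p s)"
proof -
  have c_cont: "continuous_on A c" for A
    unfolding c by (intro continuous_intros)
  have c01: "0 \<le> c s" "c s \<le> 1" if "s \<in> {0..t}" for s
    using that lam by (auto simp: c)
  have c_int: "((\<lambda>s. lam * c s) has_integral (c v - c u)) {u..v}" if "u \<le> v" for u v
    unfolding c by (rule fundamental_theorem_of_calculus[OF that])
      (auto intro!: derivative_eq_intros simp: has_real_derivative_iff_has_vector_derivative[symmetric])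
  have c_lip: "\<bar>c v - c u\<bar> \<le> lam * (v - u)" if "0 \<le> u" "u \<le> v" "v \<le> t" for u v
    using has_integral_bound[of lam "\<lambda>s. lam * c s" "c v - c u" u v] c_int[OF that(2)] lam c01 that
    by (auto simp: abs_mult)
  have cp: "set_integrable lborel {0..t} (\<lambda>s. c s *\<^sub>R p s)"
    unfolding set_integrable_def
  proof (rule Bochner_Integration.integrable_bound[OF p[unfolded set_integrable_def]])
    have "c \<in> borel_measurable lborel"
      using borel_measurable_continuous_onI[OF c_cont] by simp
    then have "(\<lambda>s. c s *\<^sub>R (indicator {0..t} s *\<^sub>R p s)) \<in> borel_measurable lborel"
      by (intro borel_measurable_scaleR borel_measurable_integrable[OF p[unfolded set_integrable_def]])
    then show "(\<lambda>s. indicator {0..t} s *\<^sub>R c s *\<^sub>R p s) \<in> borel_measurable lborel"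
      by (simp only: scaleR_scaleR mult.commute)
    show "AE s in lborel. norm (indicator {0..t} s *\<^sub>R c s *\<^sub>R p s) \<le> norm (indicator {0..t} s *\<^sub>R p s)"
      using c01 by (intro AE_I2) (auto simp: indicator_def intro!: mult_left_le_one_le)
  qed
  have p_on: "p integrable_on {u..v}" and cp_on: "(\<lambda>s. c s *\<^sub>R p s) integrable_on {u..v}"
    if "0 \<le> u" "v \<le> t" for u v
    using integrable_on_subinterval[OF set_borel_integral_eq_integral(1)[OF p]]
      integrable_on_subinterval[OF set_borel_integral_eq_integral(1)[OF cp]] that by auto
  have y_on: "y integrable_on {u..v}" if "0 \<le> u" "v \<le> t" for u v
    using that by (intro integrable_continuous_interval continuous_on_subset[OF y]) auto
  obtain K where K: "\<And>s. s \<in> {0..t} \<Longrightarrow> norm (y s) \<le> K"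
    using compact_imp_bounded[OF compact_continuous_image[OF y compact_Icc]]
    unfolding bounded_iff by (metis imageI)
  define A where "A s = integral {0..s} (\<lambda>r. c r *\<^sub>R p r)" for s
  \<comment> \<open>The limit is the total increment of \<open>\<Phi>\<close>, so it is enough that each term of the Riemann sum
    matches an increment of \<open>\<Phi>\<close> up to \<open>o(v - u)\<close>.\<close>
  define \<Phi> where "\<Phi> s = c s *\<^sub>R y s - lam *\<^sub>R A s" for s
  \<comment> \<open>The difference is the integral over \<open>{u..v}\<close> of \<open>lam\<close>
    times \<open>c u (y s - y v) + (c u - c s) (y v - p s)\<close>. Oscillation of \<open>y\<close>
    controls the first term; the Lipschitz bound on \<open>c\<close> makes the second of order
    \<open>v - u\<close>.\<close>
  have increment_error: "norm (c u *\<^sub>R (G v - G u) - (\<Phi> v - \<Phi> u)) \<le> lam * (\<epsilon> + lam * (v - u) * (K + C)) * (v - u)"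
    if uv: "0 \<le> u" "u \<le> v" "v \<le> t" and osc: "\<And>s. s \<in> {u..v} \<Longrightarrow> norm (y s - y v) \<le> \<epsilon>" for u v \<epsilon>
  proof -
    have "G v - G u = y v - y u + lam *\<^sub>R integral {u..v} (\<lambda>r. y r - p r)"
    proof -
      have *: "integral {0..u} (\<lambda>r. y r - p r) + integral {u..v} (\<lambda>r. y r - p r) = integral {0..v} (\<lambda>r. y r - p r)"
        using uv by (intro Henstock_Kurzweil_Integration.integral_combine integrable_diff y_on p_on) auto
      then show ?thesis using G[of u] G[of v] uv by (simp add: scaleR_right_distrib flip: *)
    qed
    moreover have "A v - A u = integral {u..v} (\<lambda>r. c r *\<^sub>R p r)"
      using Henstock_Kurzweil_Integration.integral_combine[of 0 u v "\<lambda>r. c r *\<^sub>R p r"] uv cp_on[of 0 v]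
      unfolding A_def by (metis add_diff_cancel_left' order_refl)
    moreover have "(c v - c u) *\<^sub>R y v = integral {u..v} (\<lambda>s. (lam * c s) *\<^sub>R y v)"
      using integral_unique[OF has_integral_scaleR_left[OF c_int[OF uv(2)], of "y v"]] by simp
    moreover have "c u *\<^sub>R (G v - G u) - (\<Phi> v - \<Phi> u)
        = c u *\<^sub>R (G v - G u) - (c v - c u) *\<^sub>R y v - c u *\<^sub>R (y v - y u) + lam *\<^sub>R (A v - A u)"
      by (simp add: \<Phi>_def algebra_simps)
    moreover have "integral {u..v} (\<lambda>r. y r - p r) = integral {u..v} y - integral {u..v} p"
      using uv by (intro integral_diff y_on p_on)
    ultimately have "c u *\<^sub>R (G v - G u) - (\<Phi> v - \<Phi> u)
        = lam *\<^sub>R (c u *\<^sub>R (integral {u..v} y - integral {u..v} p)) + lam *\<^sub>R integral {u..v} (\<lambda>r. c r *\<^sub>R p r)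
          - integral {u..v} (\<lambda>s. (lam * c s) *\<^sub>R y v)"
      by (simp only:) (simp add: algebra_simps)
    also have "((\<lambda>s. lam *\<^sub>R (c u *\<^sub>R (y s - p s)) + lam *\<^sub>R (c s *\<^sub>R p s) - (lam * c s) *\<^sub>R y v)
         has_integral \<dots>) {u..v}"
      using uv has_integral_scaleR_left[OF c_int[OF uv(2)], of "y v"]
      by (intro has_integral_add has_integral_diff has_integral_cmul integrable_integral y_on p_on cp_on) (auto intro!: has_integral_integrable)
    finally have hi: "((\<lambda>s. lam *\<^sub>R (c u *\<^sub>R (y s - p s)) + lam *\<^sub>R (c s *\<^sub>R p s) - (lam * c s) *\<^sub>R y v)
         has_integral (c u *\<^sub>R (G v - G u) - (\<Phi> v - \<Phi> u))) {u..v}" .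
    have "norm (c u *\<^sub>R (G v - G u) - (\<Phi> v - \<Phi> u)) \<le> lam * (\<epsilon> + lam * (v - u) * (K + C)) * Henstock_Kurzweil_Integration.content (cbox u v)"
    proof (rule has_integral_bound)
      have "0 \<le> \<epsilon>" using osc[of v] uv by (metis atLeastAtMost_iff norm_ge_zero order_refl order_trans)
      moreover have "0 \<le> K + C" using order_trans[OF norm_ge_zero K[of 0]] order_trans[OF norm_ge_zero pC[of 0]] t by simp
      ultimately show "0 \<le> lam * (\<epsilon> + lam * (v - u) * (K + C))" using lam uv by simp
      show "((\<lambda>s. lam *\<^sub>R (c u *\<^sub>R (y s - p s)) + lam *\<^sub>R (c s *\<^sub>R p s) - (lam * c s) *\<^sub>R y v)
         has_integral (c u *\<^sub>R (G v - G u) - (\<Phi> v - \<Phi> u))) (cbox u v)"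
        using hi by simp
      fix s assume "s \<in> cbox u v"
      then have s: "s \<in> {u..v}" "s \<in> {0..t}" using uv by auto
      have "norm (c u *\<^sub>R (y s - y v) + (c u - c s) *\<^sub>R (y v - p s)) \<le> c u * norm (y s - y v) + \<bar>c u - c s\<bar> * norm (y v - p s)"
        using c01(1)[of u] uv by (intro norm_triangle_le) simp
      also have "\<dots> \<le> 1 * \<epsilon> + lam * (v - u) * (K + C)"
      proof (intro add_mono mult_mono)
        show "\<bar>c u - c s\<bar> \<le> lam * (v - u)"
          using c_lip[of u s] s uv lam by (auto simp: abs_minus_commute intro: order_trans)
        show "norm (y v - p s) \<le> K + C"
          using norm_triangle_ineq4[of "y v" "p s"] K[of v] pC[of s] uv s by auto
      qed (use c01[of u] uv osc[OF s(1)] lam in auto)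
      finally have "norm (c u *\<^sub>R (y s - y v) + (c u - c s) *\<^sub>R (y v - p s)) \<le> \<epsilon> + lam * (v - u) * (K + C)" by simp
      moreover have "lam *\<^sub>R (c u *\<^sub>R (y s - p s)) + lam *\<^sub>R (c s *\<^sub>R p s) - (lam * c s) *\<^sub>R y v
          = lam *\<^sub>R (c u *\<^sub>R (y s - y v) + (c u - c s) *\<^sub>R (y v - p s))"
        by (simp add: algebra_simps)
      ultimately show "norm (lam *\<^sub>R (c u *\<^sub>R (y s - p s)) + lam *\<^sub>R (c s *\<^sub>R p s) - (lam * c s) *\<^sub>R y v)
          \<le> lam * (\<epsilon> + lam * (v - u) * (K + C))"
        using lam by (simp only: norm_scaleR) simp
    qed
    then show ?thesis using uv by simp
  qed
  define S where "S n = (\<Sum>k<n. c (real k * (t / real n)) *\<^sub>R (G (real (Suc k) * (t / real n)) - G (real k * (t / real n))))" for n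
  have "S \<longlonglongrightarrow> \<Phi> t - \<Phi> 0"
  proof (rule metric_LIMSEQ_I)
    fix e :: real assume e: "0 < e"
    \<comment> \<open>The oscillation errors sum to at most
      \<open>lam * t * \<epsilon> \<le> e / 4\<close>, the Lipschitz errors to
      \<open>L / real n\<close>. The summand 1 keeps the denominator positive when
      \<open>t = 0\<close>.\<close>
    define \<epsilon> where "\<epsilon> = e / (4 * (lam * t + 1))"
    have pos: "0 < lam * t + 1" using lam t by (simp add: add_nonneg_pos)
    then have \<epsilon>0: "0 < \<epsilon>" using e by (simp add: \<epsilon>_def)
    moreover have "w * (e / (4 * w)) = e / 4" if "w > 0" for w :: real
      using that by simp
    with pos have "(lam * t + 1) * \<epsilon> = e / 4" unfolding \<epsilon>_def by blast
    ultimately have \<epsilon>: "0 < \<epsilon>" "lam * t * \<epsilon> \<le> e / 4" by (simp_all add: distrib_right)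
    have "uniformly_continuous_on {0..t} y"
      using y by (rule compact_uniformly_continuous) simp
    then obtain \<delta> where \<delta>: "0 < \<delta>" "\<And>s s'. s \<in> {0..t} \<Longrightarrow> s' \<in> {0..t} \<Longrightarrow> dist s' s < \<delta> \<Longrightarrow> dist (y s') (y s) < \<epsilon>"
      unfolding uniformly_continuous_on_def using \<epsilon>(1) by meson
    define L where "L = lam * lam * (K + C) * t * t"
    have "\<forall>\<^sub>F n in sequentially. t / real n < \<delta>" "\<forall>\<^sub>F n in sequentially. L / real n < e / 4"
      using \<delta>(1) e by (auto intro: order_tendstoD(2)[OF lim_const_over_n])
    then have "\<forall>\<^sub>F n in sequentially. t / real n < \<delta> \<and> L / real n < e / 4 \<and> 0 < n"
      using eventually_gt_at_top[of 0] by eventually_elim simp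
    then have "\<forall>\<^sub>F n in sequentially. dist (S n) (\<Phi> t - \<Phi> 0) < e"
    proof eventually_elim
      case (elim n)
      define d where "d = t / real n"
      have d: "0 \<le> d" "real n * d = t" using elim t by (auto simp: d_def)
      have tele: "\<Phi> t - \<Phi> 0 = (\<Sum>k<n. \<Phi> (real (Suc k) * d) - \<Phi> (real k * d))"
        using sum_lessThan_telescope[of "\<lambda>k. \<Phi> (real k * d)" n] d by simp
      have "dist (S n) (\<Phi> t - \<Phi> 0) = norm (\<Sum>k<n. c (real k * d) *\<^sub>R (G (real (Suc k) * d) - G (real k * d))
           - (\<Phi> (real (Suc k) * d) - \<Phi> (real k * d)))"
        unfolding dist_norm tele S_def d_def[symmetric] by (simp only: sum_subtractf)
      also have "\<dots> \<le> (\<Sum>k<n. lam * (\<epsilon> + lam * d * (K + C)) * d)"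
      proof (rule sum_norm_le)
        fix k assume "k \<in> {..<n}"
        then have k: "real (Suc k) * d \<le> t"
          using d mult_right_mono[of "real (Suc k)" "real n" d] by simp
        have "norm (y s - y (real (Suc k) * d)) \<le> \<epsilon>" if "s \<in> {real k * d..real (Suc k) * d}" for s
          using \<delta>(2)[of "real (Suc k) * d" s] that k d elim
          by (auto simp: dist_norm algebra_simps d_def[symmetric] intro!: less_imp_le)
             (smt (verit) mult_nonneg_nonneg of_nat_0_le_iff)
        then show "norm (c (real k * d) *\<^sub>R (G (real (Suc k) * d) - G (real k * d))
           - (\<Phi> (real (Suc k) * d) - \<Phi> (real k * d))) \<le> lam * (\<epsilon> + lam * d * (K + C)) * d"
          using increment_error[of "real k * d" "real (Suc k) * d" \<epsilon>] k d by (simp add: algebra_simps)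
      qed
      also have "\<dots> = lam * (real n * d) * \<epsilon> + lam * lam * (K + C) * (real n * d) * d"
        by (simp add: algebra_simps)
      also have "\<dots> = lam * t * \<epsilon> + L / real n"
        unfolding d(2) by (simp add: d_def L_def)
      also have "\<dots> < e"
      proof -
        have "L / real n < e / 4" using elim by blast
        then show ?thesis using \<epsilon>(2) e by linarith
      qed
      finally show ?case .
    qed
    then show "\<exists>N. \<forall>n\<ge>N. dist (S n) (\<Phi> t - \<Phi> 0) < e"
      by (simp add: eventually_sequentially)
  qed
  moreover have "\<Phi> t - \<Phi> 0 = y t - c 0 *\<^sub>R y 0 - lam *\<^sub>R integral {0..t} (\<lambda>s. c s *\<^sub>R p s)"
    by (simp add: \<Phi>_def A_def c)
  ultimately show ?thesis by (simp add: S_def[abs_def])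
qed

section \<open>Exponential bounds for the stochastic convolution\<close>

lemma progressively_measurable_set_integral:
  fixes b :: "real \<Rightarrow> 'a \<Rightarrow> real^'n"
  assumes "filtered_prob_space P F" "progressively_measurable F T b" "0 \<le> t" "t \<le> T"
  shows "(\<lambda>\<omega>. LINT s:{0..t}|lborel. b s \<omega>) \<in> borel_measurable (F t)"
proof -
  interpret R: sigma_finite_measure "restrict_space lborel {0..t}"
    by (rule sigma_finite_measure_restrict_space) (auto intro: lborel.sigma_finite_measure_axioms)
  have "(\<lambda>\<omega>. \<integral>s. b s \<omega> \<partial>restrict_space lborel {0..t}) \<in> borel_measurable (F t)"
    using progressively_measurable_lborel[OF assms] by (rule R.borel_measurable_lebesgue_integral)
  then show ?thesis
    by (simp add: integral_restrict_space set_lebesgue_integral_def)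
qed

text \<open>The one-step bound is iterated with the earlier factors absorbed into the weight.
  Increment \<open>k\<close> is tested with \<open>c k\<close> times \<theta>, so the variance
  proxies add up with the squared weights.\<close>

lemma weighted_increments_exp_bound:
  fixes G :: "real \<Rightarrow> 'a \<Rightarrow> real^'n" and W :: "'a \<Rightarrow> ennreal"
  assumes fps: "filtered_prob_space P F"
    and step: "\<And>s t W \<theta>. 0 \<le> s \<Longrightarrow> s \<le> t \<Longrightarrow> t \<le> T \<Longrightarrow> W \<in> borel_measurable (F s) \<Longrightarrow>
      (\<integral>\<^sup>+\<omega>. W \<omega> * ennreal (exp (\<theta> \<bullet> (G t \<omega> - G s \<omega>))) \<partial>P)
       \<le> ennreal (exp ((norm \<theta>)\<^sup>2 / 2 * (h\<^sup>2 * (t - s)))) * (\<integral>\<^sup>+\<omega>. W \<omega> \<partial>P)"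
    and G: "\<And>t. t \<in> {0..T} \<Longrightarrow> G t \<in> borel_measurable (F t)"
    and W: "W \<in> borel_measurable (F 0)"
    and \<delta>: "0 \<le> \<delta>" "real n * \<delta> \<le> T"
  shows "(\<integral>\<^sup>+\<omega>. W \<omega> * ennreal (exp (\<theta> \<bullet> (\<Sum>k<n. c k *\<^sub>R (G (real (Suc k) * \<delta>) \<omega> - G (real k * \<delta>) \<omega>)))) \<partial>P)
    \<le> ennreal (exp ((norm \<theta>)\<^sup>2 / 2 * (h\<^sup>2 * (\<Sum>k<n. (c k)\<^sup>2 * \<delta>)))) * (\<integral>\<^sup>+\<omega>. W \<omega> \<partial>P)"
proof -
  define S where "S l \<omega> = (\<Sum>k<l. c k *\<^sub>R (G (real (Suc k) * \<delta>) \<omega> - G (real k * \<delta>) \<omega>))" for l \<omega>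
  have "(\<lambda>\<omega>. W \<omega> * ennreal (exp (\<theta> \<bullet> S l \<omega>))) \<in> borel_measurable (F (real l * \<delta>)) \<and>
    (\<integral>\<^sup>+\<omega>. W \<omega> * ennreal (exp (\<theta> \<bullet> S l \<omega>)) \<partial>P)
    \<le> ennreal (exp ((norm \<theta>)\<^sup>2 / 2 * (h\<^sup>2 * (\<Sum>k<l. (c k)\<^sup>2 * \<delta>)))) * (\<integral>\<^sup>+\<omega>. W \<omega> \<partial>P)" if "l \<le> n" for l
    using that
  proof (induction l)
    case 0
    then show ?case using W by (simp add: S_def)
  next
    case (Suc l)
    define V where "V \<omega> = W \<omega> * ennreal (exp (\<theta> \<bullet> S l \<omega>))" for \<omega>
    have V: "V \<in> borel_measurable (F (real l * \<delta>))"
      and IV: "(\<integral>\<^sup>+\<omega>. V \<omega> \<partial>P) \<le> ennreal (exp ((norm \<theta>)\<^sup>2 / 2 * (h\<^sup>2 * (\<Sum>k<l. (c k)\<^sup>2 * \<delta>)))) * (\<integral>\<^sup>+\<omega>. W \<omega> \<partial>P)"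
      using Suc by (simp_all add: V_def[abs_def])
    have times: "0 \<le> real l * \<delta>" "real l * \<delta> \<le> real (Suc l) * \<delta>" "real (Suc l) * \<delta> \<le> T"
      using \<delta> Suc.prems mult_right_mono[of "real (Suc l)" "real n" \<delta>] by (auto simp: algebra_simps)
    have split: "W \<omega> * ennreal (exp (\<theta> \<bullet> S (Suc l) \<omega>))
        = V \<omega> * ennreal (exp ((c l *\<^sub>R \<theta>) \<bullet> (G (real (Suc l) * \<delta>) \<omega> - G (real l * \<delta>) \<omega>)))" for \<omega>
      by (simp add: V_def S_def inner_add_right exp_add ennreal_mult' mult.assoc)
    have [measurable]: "V \<in> borel_measurable (F (real (Suc l) * \<delta>))"
      "G (real (Suc l) * \<delta>) \<in> borel_measurable (F (real (Suc l) * \<delta>))"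
      "G (real l * \<delta>) \<in> borel_measurable (F (real (Suc l) * \<delta>))"
      using V G[of "real (Suc l) * \<delta>"] G[of "real l * \<delta>"] times filtered_measurable_mono[OF fps times(2)] by auto
    have meas: "(\<lambda>\<omega>. W \<omega> * ennreal (exp (\<theta> \<bullet> S (Suc l) \<omega>))) \<in> borel_measurable (F (real (Suc l) * \<delta>))"
      unfolding split by measurable
    have "(\<integral>\<^sup>+\<omega>. W \<omega> * ennreal (exp (\<theta> \<bullet> S (Suc l) \<omega>)) \<partial>P)
      \<le> ennreal (exp ((norm (c l *\<^sub>R \<theta>))\<^sup>2 / 2 * (h\<^sup>2 * (real (Suc l) * \<delta> - real l * \<delta>)))) * (\<integral>\<^sup>+\<omega>. V \<omega> \<partial>P)"
      unfolding split by (rule step[OF times V])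
    also have "\<dots> \<le> ennreal (exp ((norm (c l *\<^sub>R \<theta>))\<^sup>2 / 2 * (h\<^sup>2 * (real (Suc l) * \<delta> - real l * \<delta>))))
        * (ennreal (exp ((norm \<theta>)\<^sup>2 / 2 * (h\<^sup>2 * (\<Sum>k<l. (c k)\<^sup>2 * \<delta>)))) * (\<integral>\<^sup>+\<omega>. W \<omega> \<partial>P))"
      by (rule mult_left_mono[OF IV]) simp
    also have "\<dots> = ennreal (exp ((norm \<theta>)\<^sup>2 / 2 * (h\<^sup>2 * (\<Sum>k<Suc l. (c k)\<^sup>2 * \<delta>)))) * (\<integral>\<^sup>+\<omega>. W \<omega> \<partial>P)"
      by (simp add: mult.assoc[symmetric] ennreal_mult'[symmetric] exp_add[symmetric])
         (simp add: algebra_simps add_divide_distrib power_mult_distrib)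
    finally have "(\<integral>\<^sup>+\<omega>. W \<omega> * ennreal (exp (\<theta> \<bullet> S (Suc l) \<omega>)) \<partial>P)
      \<le> ennreal (exp ((norm \<theta>)\<^sup>2 / 2 * (h\<^sup>2 * (\<Sum>k<Suc l. (c k)\<^sup>2 * \<delta>)))) * (\<integral>\<^sup>+\<omega>. W \<omega> \<partial>P)" .
    with meas show ?case ..
  qed
  from this[of n] show ?thesis by (simp add: S_def)
qed

text \<open>Multiply \<open>le\<close> by \<open>exp (- (norm \<theta>)\<^sup>2 / (4 * a))\<close>,
  integrate over \<theta> and exchange the integrals. On the right the proxy \<open>q\<close> widens
  the Gaussian: \<open>1 / (4 * a') = 1 / (4 * a) - q / 2\<close>, that is
  \<open>a' = a / (1 - 2 * a * q)\<close>. The prefactor is the ratio of the two normalising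
  constants.\<close>

lemma gaussian_integration_exp_bound:
  fixes Y U :: "'a \<Rightarrow> 'b::euclidean_space"
  assumes "prob_space P" and Y[measurable]: "Y \<in> borel_measurable P" and U[measurable]: "U \<in> borel_measurable P"
    and a: "0 < a" and q: "2 * a * q < 1"
    and le: "\<And>\<theta>. (\<integral>\<^sup>+\<omega>. ennreal (exp (\<theta> \<bullet> Y \<omega>)) \<partial>P)
        \<le> ennreal (exp ((norm \<theta>)\<^sup>2 / 2 * q)) * (\<integral>\<^sup>+\<omega>. ennreal (exp (\<theta> \<bullet> U \<omega>)) \<partial>P)"
  shows "(\<integral>\<^sup>+\<omega>. ennreal (exp (a * (norm (Y \<omega>))\<^sup>2)) \<partial>P)
    \<le> ennreal (sqrt (1 / (1 - 2 * a * q)) ^ DIM('b)) * (\<integral>\<^sup>+\<omega>. ennreal (exp (a / (1 - 2 * a * q) * (norm (U \<omega>))\<^sup>2)) \<partial>P)"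
proof -
  interpret prob_space P by fact
  interpret pair_sigma_finite P "lborel :: 'b measure" ..
  define a' where "a' = a / (1 - 2 * a * q)"
  have a': "0 < a'" using a q by (simp add: a'_def)
  have inv: "1 / (4 * a') = 1 / (4 * a) - q / 2"
    using a q by (simp add: a'_def field_simps)
  define K where "K x = ennreal (sqrt (4 * pi * x) ^ DIM('b))" for x
  have gauss: "K x * (\<integral>\<^sup>+\<omega>. ennreal (exp (x * (norm (Z \<omega>))\<^sup>2)) \<partial>P)
      = (\<integral>\<^sup>+\<theta>. \<integral>\<^sup>+\<omega>. ennreal (exp (\<theta> \<bullet> Z \<omega> - (norm \<theta>)\<^sup>2 / (4 * x))) \<partial>P \<partial>lborel)"
    if x: "0 < x" and [measurable]: "Z \<in> borel_measurable P" for x and Z :: "'a \<Rightarrow> 'b"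
  proof -
    have "K x * (\<integral>\<^sup>+\<omega>. ennreal (exp (x * (norm (Z \<omega>))\<^sup>2)) \<partial>P)
        = (\<integral>\<^sup>+\<omega>. K x * ennreal (exp (x * (norm (Z \<omega>))\<^sup>2)) \<partial>P)"
      by (rule nn_integral_cmult[symmetric]) simp
    also have "\<dots> = (\<integral>\<^sup>+\<omega>. \<integral>\<^sup>+\<theta>. ennreal (exp (\<theta> \<bullet> Z \<omega> - (norm \<theta>)\<^sup>2 / (4 * x))) \<partial>lborel \<partial>P)"
      unfolding nn_integral_exp_inner_minus_norm_square[OF x] K_def
      using x by (simp add: ennreal_mult')
    also have "\<dots> = (\<integral>\<^sup>+\<theta>. \<integral>\<^sup>+\<omega>. ennreal (exp (\<theta> \<bullet> Z \<omega> - (norm \<theta>)\<^sup>2 / (4 * x))) \<partial>P \<partial>lborel)"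
      by (rule Fubini'[symmetric]) measurable
    finally show ?thesis .
  qed
  have "K a * (\<integral>\<^sup>+\<omega>. ennreal (exp (a * (norm (Y \<omega>))\<^sup>2)) \<partial>P)
      \<le> K a' * (\<integral>\<^sup>+\<omega>. ennreal (exp (a' * (norm (U \<omega>))\<^sup>2)) \<partial>P)"
    unfolding gauss[OF a Y] gauss[OF a' U]
  proof (rule nn_integral_mono)
    fix \<theta> :: 'b
    have pull: "(\<integral>\<^sup>+\<omega>. ennreal (exp (\<theta> \<bullet> Z \<omega> - r)) \<partial>P) = ennreal (exp (- r)) * (\<integral>\<^sup>+\<omega>. ennreal (exp (\<theta> \<bullet> Z \<omega>)) \<partial>P)"
      if [measurable]: "Z \<in> borel_measurable P" for Z r
      by (subst nn_integral_cmult[symmetric]) (simp_all add: ennreal_mult'[symmetric] exp_add[symmetric])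
    have "(\<integral>\<^sup>+\<omega>. ennreal (exp (\<theta> \<bullet> Y \<omega> - (norm \<theta>)\<^sup>2 / (4 * a))) \<partial>P)
        \<le> ennreal (exp (- ((norm \<theta>)\<^sup>2 / (4 * a)))) * (ennreal (exp ((norm \<theta>)\<^sup>2 / 2 * q)) * (\<integral>\<^sup>+\<omega>. ennreal (exp (\<theta> \<bullet> U \<omega>)) \<partial>P))"
      unfolding pull[OF Y] by (rule mult_left_mono[OF le]) simp
    also have "\<dots> = ennreal (exp (- ((norm \<theta>)\<^sup>2 / (4 * a')))) * (\<integral>\<^sup>+\<omega>. ennreal (exp (\<theta> \<bullet> U \<omega>)) \<partial>P)"
    proof -
      have "- ((norm \<theta>)\<^sup>2 / (4 * a)) + (norm \<theta>)\<^sup>2 / 2 * q = - ((norm \<theta>)\<^sup>2 * (1 / (4 * a')))"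
        unfolding inv by (simp add: algebra_simps)
      then show ?thesis
        by (simp add: mult.assoc[symmetric] ennreal_mult'[symmetric] exp_add[symmetric])
    qed
    finally show "(\<integral>\<^sup>+\<omega>. ennreal (exp (\<theta> \<bullet> Y \<omega> - (norm \<theta>)\<^sup>2 / (4 * a))) \<partial>P)
        \<le> (\<integral>\<^sup>+\<omega>. ennreal (exp (\<theta> \<bullet> U \<omega> - (norm \<theta>)\<^sup>2 / (4 * a'))) \<partial>P)"
      unfolding pull[OF U] .
  qed
  moreover have "K a' = K a * ennreal (sqrt (1 / (1 - 2 * a * q)) ^ DIM('b))"
    unfolding K_def a'_def using a
    by (subst ennreal_mult'[symmetric]) (auto simp flip: power_mult_distrib real_sqrt_mult)
  ultimately have "K a * (\<integral>\<^sup>+\<omega>. ennreal (exp (a * (norm (Y \<omega>))\<^sup>2)) \<partial>P)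
      \<le> K a * (ennreal (sqrt (1 / (1 - 2 * a * q)) ^ DIM('b)) * (\<integral>\<^sup>+\<omega>. ennreal (exp (a' * (norm (U \<omega>))\<^sup>2)) \<partial>P))"
    by (simp add: mult.assoc)
  moreover have "0 < K a" "K a < \<top>" using a by (auto simp: K_def)
  ultimately show ?thesis
    unfolding a'_def by (subst (asm) ennreal_mult_le_mult_iff) auto
qed

text \<open>Variation of constants for \<open>X - z\<close> with source \<open>q - z\<close> leaves
  a part known at time 0 and the limit of weighted sums of increments. The exponential of the first
  part serves as the weight when the sums are bounded, and Fatou's lemma passes to the
  limit.\<close>

lemma ito_linear_drift_exp_bound:
  fixes X :: "real \<Rightarrow> 'a \<Rightarrow> real^'n"
  assumes fps: "filtered_prob_space P F" and bm: "brownian_motion P F B"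
    and ito: "ito_process P F B T (\<lambda>t \<omega>. - lam *\<^sub>R (X t \<omega> - q t)) H X"
    and lam: "0 < lam" and t: "t \<in> {0..T}"
    and Hh: "\<And>u \<omega>. u \<in> {0..T} \<Longrightarrow> \<omega> \<in> space P \<Longrightarrow> \<bar>H u \<omega>\<bar> \<le> h"
    and qC: "\<And>u. u \<in> {0..T} \<Longrightarrow> norm (q u - z) \<le> C"
  defines "x \<equiv> exp (- lam * t)"
  shows "\<exists>u. norm u \<le> (1 - x) * C \<and> (\<forall>\<theta>. (\<integral>\<^sup>+\<omega>. ennreal (exp (\<theta> \<bullet> (X t \<omega> - z))) \<partial>P)
      \<le> ennreal (exp ((norm \<theta>)\<^sup>2 / 2 * (h\<^sup>2 * ((1 - x\<^sup>2) / (2 * lam)))))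
        * (\<integral>\<^sup>+\<omega>. ennreal (exp (\<theta> \<bullet> (x *\<^sub>R (X 0 \<omega> - z) + u))) \<partial>P))"
proof -
  interpret prob_space P using fps by (simp add: filtered_prob_space_def)
  define b where "b s \<omega> = - lam *\<^sub>R (X s \<omega> - q s)" for s \<omega>
  have T0: "0 \<le> T" and t0: "0 \<le> t" using t by auto
  have Xm: "X s \<in> borel_measurable (F s)" if "s \<in> {0..T}" for s
    using ito that by (simp add: ito_process_def)
  have cont: "AE \<omega> in P. continuous_on {0..T} (\<lambda>s. X s \<omega>)"
    and bint: "AE \<omega> in P. set_integrable lborel {0..T} (\<lambda>s. b s \<omega>)"
    and bprog: "progressively_measurable F T b"
    using ito by (simp_all add: ito_process_def b_def[abs_def])
  obtain I where I: "has_ito_integral P F B T H I"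
    and XI: "\<And>s. s \<in> {0..T} \<Longrightarrow> AE \<omega> in P. X s \<omega> = X 0 \<omega> + (LINT r:{0..s}|lborel. b r \<omega>) + I s \<omega>"
    using ito by (auto simp: ito_process_def b_def[abs_def])
  \<comment> \<open>\<open>I s\<close> agrees with this expression only almost surely for each fixed
    \<open>s\<close>, and is only known to be measurable for \<open>P\<close>. The version
    \<open>G\<close> obeys the path identity at all times simultaneously and is adapted.\<close>
  define G where "G s \<omega> = X s \<omega> - X 0 \<omega> - (LINT r:{0..s}|lborel. b r \<omega>)" for s \<omega>
  have GI: "AE \<omega> in P. G s \<omega> = I s \<omega>" if "s \<in> {0..T}" for s
    using XI[OF that] by eventually_elim (simp add: G_def)
  have Gm: "G s \<in> borel_measurable (F s)" if s: "s \<in> {0..T}" for s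
    unfolding G_def[abs_def]
    using s filtered_measurable_mono[OF fps _ Xm[of 0], of s] T0
    by (intro borel_measurable_diff Xm progressively_measurable_set_integral[OF fps bprog]) auto
  have step: "(\<integral>\<^sup>+\<omega>. W \<omega> * ennreal (exp (\<theta> \<bullet> (G v \<omega> - G s \<omega>))) \<partial>P)
       \<le> ennreal (exp ((norm \<theta>)\<^sup>2 / 2 * (h\<^sup>2 * (v - s)))) * (\<integral>\<^sup>+\<omega>. W \<omega> \<partial>P)"
    if sv: "0 \<le> s" "s \<le> v" "v \<le> T" and W: "W \<in> borel_measurable (F s)" for s v W \<theta>
  proof -
    have "(\<integral>\<^sup>+\<omega>. W \<omega> * ennreal (exp (\<theta> \<bullet> (G v \<omega> - G s \<omega>))) \<partial>P)
        = (\<integral>\<^sup>+\<omega>. W \<omega> * ennreal (exp (\<theta> \<bullet> (I v \<omega> - I s \<omega>))) \<partial>P)"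
    proof (rule nn_integral_cong_AE)
      show "AE \<omega> in P. W \<omega> * ennreal (exp (\<theta> \<bullet> (G v \<omega> - G s \<omega>))) = W \<omega> * ennreal (exp (\<theta> \<bullet> (I v \<omega> - I s \<omega>)))"
        using GI[of v] GI[of s] sv by (auto elim: eventually_elim2)
    qed
    also have "\<dots> \<le> ennreal (exp ((norm \<theta>)\<^sup>2 / 2 * (h\<^sup>2 * (v - s)))) * (\<integral>\<^sup>+\<omega>. W \<omega> \<partial>P)"
      by (rule ito_increment_exp_bound[OF fps bm I sv Hh W])
    finally show ?thesis .
  qed
  define p where "p s = q s - z" for s
  define c where "c s = exp (- lam * (t - s))" for s
  define u where "u = lam *\<^sub>R integral {0..t} (\<lambda>s. c s *\<^sub>R p s)"
  have pC: "norm (p s) \<le> C" if "s \<in> {0..t}" for s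
    using qC[of s] that t by (simp add: p_def)
  \<comment> \<open>The source is deterministic, so integrability can be read off a single good
    path, through \<open>p = (X - z) + b / lam\<close>. Such a path exists because \<open>P\<close>
    has total mass 1.\<close>
  have p_int: "set_integrable lborel {0..t} p"
  proof -
    obtain \<omega> where \<omega>: "continuous_on {0..T} (\<lambda>s. X s \<omega>)" "set_integrable lborel {0..T} (\<lambda>s. b s \<omega>)"
      using eventually_happens'[OF _ eventually_conj[OF cont bint]] by (auto simp: ae_filter_bot)
    have "set_integrable lborel {0..t} (\<lambda>s. X s \<omega> - z)"
      using \<omega>(1) t by (intro borel_integrable_atLeastAtMost' continuous_intros continuous_on_subset[OF \<omega>(1)]) auto
    moreover have "set_integrable lborel {0..t} (\<lambda>s. (1 / lam) *\<^sub>R b s \<omega>)"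
      using set_integrable_subset[OF \<omega>(2), of "{0..t}"] t by (intro set_integrable_scaleR_right) auto
    ultimately have "set_integrable lborel {0..t} (\<lambda>s. (X s \<omega> - z) + (1 / lam) *\<^sub>R b s \<omega>)"
      by (rule set_integral_add)
    also have "(\<lambda>s. (X s \<omega> - z) + (1 / lam) *\<^sub>R b s \<omega>) = p"
      using lam by (auto simp: b_def p_def)
    finally show ?thesis .
  qed
  define D where "D n \<omega> = (\<Sum>k<n. c (real k * (t / real n)) *\<^sub>R (G (real (Suc k) * (t / real n)) \<omega> - G (real k * (t / real n)) \<omega>))" for n \<omega>
  have lim: "AE \<omega> in P. (\<lambda>n. D n \<omega>) \<longlonglongrightarrow> (X t \<omega> - z) - (x *\<^sub>R (X 0 \<omega> - z) + u)"
    using cont bint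
  proof eventually_elim
    case (elim \<omega>)
    have cX: "continuous_on {0..t} (\<lambda>s. X s \<omega> - z)"
      using t by (intro continuous_intros continuous_on_subset[OF elim(1)]) auto
    have "G s \<omega> = (X s \<omega> - z) - (X 0 \<omega> - z) + lam *\<^sub>R integral {0..s} (\<lambda>r. (X r \<omega> - z) - p r)" if s: "s \<in> {0..t}" for s
    proof -
      have "(LINT r:{0..s}|lborel. b r \<omega>) = integral {0..s} (\<lambda>r. b r \<omega>)"
        using set_integrable_subset[OF elim(2), of "{0..s}"] s t
        by (intro set_borel_integral_eq_integral(2)) auto
      also have "\<dots> = - lam *\<^sub>R integral {0..s} (\<lambda>r. (X r \<omega> - z) - p r)"
        unfolding b_def p_def by (subst integral_cmul[symmetric]) simp
      finally show ?thesis by (simp add: G_def)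
    qed
    from variation_of_constants_riemann_sum[OF t0 lam cX p_int pC this c_def]
    show ?case unfolding D_def u_def by (simp add: c_def x_def algebra_simps)
  qed
  \<comment> \<open>As \<open>c\<close> increases, the left-endpoint sum is at most the integral of
    the square of \<open>c\<close>. Termwise,
    \<open>exp (2 * (lam * d)) \<ge> 1 + 2 * (lam * d)\<close> bounds each summand by an increment
    of \<open>c\<^sup>2 / (2 * lam)\<close>, and these telescope.\<close>
  have c_sq: "(\<Sum>k<n. (c (real k * (t / real n)))\<^sup>2 * (t / real n)) \<le> (1 - x\<^sup>2) / (2 * lam)" for n
  proof (cases "n = 0")
    case True
    then show ?thesis using lam t0 by (simp add: x_def power_le_one)
  next
    case False
    define d where "d = t / real n"
    have d: "0 \<le> d" "real n * d = t" using False t0 by (auto simp: d_def)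
    have "(c (real k * d))\<^sup>2 * d \<le> (c (real (Suc k) * d))\<^sup>2 / (2 * lam) - (c (real k * d))\<^sup>2 / (2 * lam)" for k
    proof -
      have "c (real (Suc k) * d) = c (real k * d) * exp (lam * d)"
        by (simp add: c_def exp_add[symmetric] algebra_simps)
      then have "(c (real (Suc k) * d))\<^sup>2 = (c (real k * d))\<^sup>2 * exp (2 * (lam * d))"
        by (simp add: power_mult_distrib exp_double)
      moreover have "(c (real k * d))\<^sup>2 * (1 + 2 * (lam * d)) \<le> (c (real k * d))\<^sup>2 * exp (2 * (lam * d))"
        by (intro mult_left_mono exp_ge_add_one_self) simp
      ultimately show ?thesis using lam by (simp add: field_simps)
    qed
    then have "(\<Sum>k<n. (c (real k * d))\<^sup>2 * d) \<le> (\<Sum>k<n. (c (real (Suc k) * d))\<^sup>2 / (2 * lam) - (c (real k * d))\<^sup>2 / (2 * lam))"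
      by (intro sum_mono)
    also have "\<dots> = (c (real n * d))\<^sup>2 / (2 * lam) - (c (real 0 * d))\<^sup>2 / (2 * lam)"
      by (rule sum_lessThan_telescope)
    also have "\<dots> = (1 - x\<^sup>2) / (2 * lam)"
      unfolding d(2) by (simp add: c_def x_def diff_divide_distrib)
    finally show ?thesis by (simp add: d_def)
  qed
  have "norm u \<le> (1 - x) * C"
  proof -
    have ci: "((\<lambda>s. lam * c s) has_integral (c t - c 0)) {0..t}"
      unfolding c_def by (rule fundamental_theorem_of_calculus[OF t0])
        (auto intro!: derivative_eq_intros simp: has_real_derivative_iff_has_vector_derivative[symmetric])
    then have ciC: "((\<lambda>s. lam * c s * C) has_integral (c t - c 0) * C) {0..t}"
      by (rule has_integral_mult_left)
    have "norm (integral {0..t} (\<lambda>s. lam *\<^sub>R (c s *\<^sub>R p s))) \<le> integral {0..t} (\<lambda>s. lam * c s * C)"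
    proof (cases "(\<lambda>s. lam *\<^sub>R (c s *\<^sub>R p s)) integrable_on {0..t}")
      case True
      then show ?thesis
        using ciC lam pC
        by (intro integral_norm_bound_integral) (auto simp: has_integral_integrable c_def abs_mult mult.assoc intro!: mult_left_mono)
    next
      \<comment> \<open>The integral of a non-integrable function is 0 by convention, so only
        nonnegativity of the right side remains.\<close>
      case False
      have "0 \<le> C" using pC[of 0] t0 norm_ge_zero[of "p 0"] by (metis atLeastAtMost_iff order_refl order_trans)
      then have "0 \<le> (c t - c 0) * C" using lam t0 by (simp add: c_def)
      then show ?thesis unfolding not_integrable_integral[OF False] integral_unique[OF ciC] by simp
    qed
    then show ?thesis
      unfolding u_def integral_cmul[symmetric] integral_unique[OF ciC] by (simp add: c_def x_def)
  qed
  moreover have "(\<integral>\<^sup>+\<omega>. ennreal (exp (\<theta> \<bullet> (X t \<omega> - z))) \<partial>P)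
      \<le> ennreal (exp ((norm \<theta>)\<^sup>2 / 2 * (h\<^sup>2 * ((1 - x\<^sup>2) / (2 * lam)))))
        * (\<integral>\<^sup>+\<omega>. ennreal (exp (\<theta> \<bullet> (x *\<^sub>R (X 0 \<omega> - z) + u))) \<partial>P)" for \<theta>
  proof -
    define W where "W \<omega> = ennreal (exp (\<theta> \<bullet> (x *\<^sub>R (X 0 \<omega> - z) + u)))" for \<omega>
    define K where "K = ennreal (exp ((norm \<theta>)\<^sup>2 / 2 * (h\<^sup>2 * ((1 - x\<^sup>2) / (2 * lam))))) * (\<integral>\<^sup>+\<omega>. W \<omega> \<partial>P)"
    have [measurable]: "X 0 \<in> borel_measurable (F 0)" using Xm[of 0] T0 by simp
    have W: "W \<in> borel_measurable (F 0)" unfolding W_def[abs_def] by measurable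
    \<comment> \<open>For \<open>n = 0\<close> the product is 0, since division by zero yields
      0.\<close>
    have n_le: "real n * (t / real n) \<le> T" for n using t t0 by (cases "n = 0") auto
    have D_le: "(\<integral>\<^sup>+\<omega>. W \<omega> * ennreal (exp (\<theta> \<bullet> D n \<omega>)) \<partial>P) \<le> K" for n
    proof -
      have "(\<integral>\<^sup>+\<omega>. W \<omega> * ennreal (exp (\<theta> \<bullet> D n \<omega>)) \<partial>P)
          \<le> ennreal (exp ((norm \<theta>)\<^sup>2 / 2 * (h\<^sup>2 * (\<Sum>k<n. (c (real k * (t / real n)))\<^sup>2 * (t / real n))))) * (\<integral>\<^sup>+\<omega>. W \<omega> \<partial>P)"
        unfolding D_def using t0
        by (intro weighted_increments_exp_bound[OF fps step Gm W _ n_le, where c = "\<lambda>k. c (real k * (t / real n))"]) auto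
      also have "\<dots> \<le> K"
        unfolding K_def
        by (intro mult_right_mono ennreal_leI exp_le_cancel_iff[THEN iffD2] mult_left_mono c_sq) auto
      finally show ?thesis .
    qed
    have D_P: "D n \<in> borel_measurable P" for n
    proof -
      have G_P: "G (real k * (t / real n)) \<in> borel_measurable P" if "k \<le> n" for k
      proof -
        have "real k * (t / real n) \<in> {0..T}"
          using that t0 n_le[of n] mult_right_mono[of "real k" "real n" "t / real n"] by auto
        then show ?thesis by (rule filtered_measurable[OF fps Gm])
      qed
      show ?thesis
        unfolding D_def[abs_def]
        by (intro borel_measurable_sum borel_measurable_scaleR borel_measurable_diff borel_measurable_const G_P)
          (simp_all only: lessThan_iff Suc_le_eq less_imp_le)
    qed
    have W_P: "W \<in> borel_measurable P" by (rule filtered_measurable[OF fps W])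
    have "(\<integral>\<^sup>+\<omega>. ennreal (exp (\<theta> \<bullet> (X t \<omega> - z))) \<partial>P) = (\<integral>\<^sup>+\<omega>. liminf (\<lambda>n. W \<omega> * ennreal (exp (\<theta> \<bullet> D n \<omega>))) \<partial>P)"
    proof (rule nn_integral_cong_AE)
      show "AE \<omega> in P. ennreal (exp (\<theta> \<bullet> (X t \<omega> - z))) = liminf (\<lambda>n. W \<omega> * ennreal (exp (\<theta> \<bullet> D n \<omega>)))"
        using lim
      proof eventually_elim
        case (elim \<omega>)
        have "(\<lambda>n. W \<omega> * ennreal (exp (\<theta> \<bullet> D n \<omega>)))
            \<longlonglongrightarrow> W \<omega> * ennreal (exp (\<theta> \<bullet> ((X t \<omega> - z) - (x *\<^sub>R (X 0 \<omega> - z) + u))))"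
          by (intro tendsto_mult_ennreal tendsto_const tendsto_ennrealI tendsto_intros elim) auto
        also have "W \<omega> * ennreal (exp (\<theta> \<bullet> ((X t \<omega> - z) - (x *\<^sub>R (X 0 \<omega> - z) + u)))) = ennreal (exp (\<theta> \<bullet> (X t \<omega> - z)))"
          unfolding W_def by (simp add: ennreal_mult'[symmetric] exp_add[symmetric] inner_diff_right)
        finally show ?case by (simp add: lim_imp_Liminf)
      qed
    qed
    also have "\<dots> \<le> liminf (\<lambda>n. \<integral>\<^sup>+\<omega>. W \<omega> * ennreal (exp (\<theta> \<bullet> D n \<omega>)) \<partial>P)"
      using W_P D_P by (intro nn_integral_liminf) simp
    also have "\<dots> \<le> liminf (\<lambda>n. K)"
      by (intro Liminf_mono always_eventually allI D_le)
    finally show ?thesis by (simp add: Liminf_const K_def W_def)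
  qed
  ultimately show ?thesis by blast
qed

text \<open>Gaussian integration inflates \<open>a\<close> by the factor \<open>r\<close>, and
  \<open>r * x \<le> 1\<close> lets the contraction of the initial datum compensate. What remains is
  a cost from the source and one from the normalising constants. Both are kept proportional to
  \<open>a\<close> in the exponent, so that the product over \<open>N\<close> particles is free of
  \<open>N\<close>.\<close>

lemma ito_linear_drift_square_exp_bound:
  fixes X :: "real \<Rightarrow> 'a \<Rightarrow> real^'n"
  assumes fps: "filtered_prob_space P F" and bm: "brownian_motion P F B"
    and ito: "ito_process P F B T (\<lambda>t \<omega>. - lam *\<^sub>R (X t \<omega> - q t)) H X"
    and lam: "0 < lam" and t: "t \<in> {0..T}"
    and Hh: "\<And>u \<omega>. u \<in> {0..T} \<Longrightarrow> \<omega> \<in> space P \<Longrightarrow> \<bar>H u \<omega>\<bar> \<le> h"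
    and qC: "\<And>u. u \<in> {0..T} \<Longrightarrow> norm (q u - z) \<le> C"
    and a: "0 < a" "4 * a * h\<^sup>2 \<le> lam"
  shows "(\<integral>\<^sup>+\<omega>. ennreal (exp (a * (norm (X t \<omega> - z))\<^sup>2)) \<partial>P)
    \<le> ennreal (exp (a * (4 / 3 * C\<^sup>2 + 2 / 3 * real CARD('n) * h\<^sup>2 / lam)))
      * (\<integral>\<^sup>+\<omega>. ennreal (exp (a * (norm (X 0 \<omega> - z))\<^sup>2)) \<partial>P)"
proof -
  interpret prob_space P using fps by (simp add: filtered_prob_space_def)
  define x where "x = exp (- lam * t)"
  have x: "0 < x" "x \<le> 1" using lam t by (auto simp: x_def)
  define q' where "q' = h\<^sup>2 * ((1 - x\<^sup>2) / (2 * lam))"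
  \<comment> \<open>In this dimensionless form the smallness assumption on \<open>a\<close> reads
    \<open>w \<le> 1 / 4\<close>.\<close>
  define w where "w = a * h\<^sup>2 / lam"
  have w: "0 \<le> w" "w \<le> 1 / 4" using a lam by (auto simp: w_def field_simps)
  have aq: "2 * a * q' = w * (1 - x\<^sup>2)" using lam by (simp add: q'_def w_def)
  have x2: "0 \<le> 1 - x\<^sup>2" "1 - x\<^sup>2 \<le> 1" using x by (auto simp: power_le_one)
  have aq_w: "2 * a * q' \<le> w" "0 \<le> 2 * a * q'"
    unfolding aq using w x2 mult_left_mono[of "1 - x\<^sup>2" 1 w] by auto
  have aq_x: "2 * a * q' \<le> (1 - x\<^sup>2) / 4"
    unfolding aq using w x2 mult_right_mono[of w "1 / 4" "1 - x\<^sup>2"] by auto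
  define r where "r = 1 / (1 - 2 * a * q')"
  have pos: "0 < 1 - 2 * a * q'" using aq_w w by simp
  have r0: "0 < r" using pos by (simp add: r_def)
  have rx: "r * x \<le> 1"
  proof -
    have "0 \<le> (1 - x) * (3 - x) / 4" using x by simp
    also have "\<dots> = 1 - (1 - x\<^sup>2) / 4 - x" by (simp add: field_simps power2_eq_square)
    finally have "x \<le> 1 - 2 * a * q'" using aq_x by linarith
    then show ?thesis using pos by (simp add: r_def)
  qed
  have r43: "r \<le> 4 / 3" using pos aq_w w by (simp add: r_def field_simps)
  \<comment> \<open>The constant \<open>4 / 3\<close> alone would grow exponentially over
    \<open>N\<close> particles; the identity \<open>r = 1 + 2 * a * q' * r\<close> gives a bound
    that tends to 1 with \<open>w\<close>.\<close>
  have r_exp: "r \<le> exp (4 / 3 * w)"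
  proof -
    have "r = 1 + 2 * a * q' * r" using pos by (simp add: r_def field_simps)
    also have "\<dots> \<le> 1 + w * (4 / 3)"
      using aq_w w r43 r0 by (intro add_left_mono mult_mono) auto
    also have "\<dots> \<le> exp (4 / 3 * w)" using exp_ge_add_one_self[of "4 / 3 * w"] by (simp add: mult.commute)
    finally show ?thesis .
  qed
  obtain u where u: "norm u \<le> (1 - x) * C" and
    lin: "\<And>\<theta>. (\<integral>\<^sup>+\<omega>. ennreal (exp (\<theta> \<bullet> (X t \<omega> - z))) \<partial>P)
      \<le> ennreal (exp ((norm \<theta>)\<^sup>2 / 2 * q')) * (\<integral>\<^sup>+\<omega>. ennreal (exp (\<theta> \<bullet> (x *\<^sub>R (X 0 \<omega> - z) + u))) \<partial>P)"
    using ito_linear_drift_exp_bound[OF fps bm ito lam t Hh qC] unfolding x_def[symmetric] q'_def by blast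
  have [measurable]: "X s \<in> borel_measurable P" if "s \<in> {0..T}" for s
    using ito that filtered_measurable[OF fps, of "X s" s] by (simp add: ito_process_def)
  have [measurable]: "X t \<in> borel_measurable P" "X 0 \<in> borel_measurable P"
    using t by auto
  have C: "0 \<le> C" using qC[OF t] norm_ge_zero order_trans by blast
  \<comment> \<open>The bound on \<open>u\<close> gives a convex combination of
    \<open>norm y\<close> and \<open>C\<close>. Convexity of the square then gives the coefficient
    \<open>x\<close> on \<open>(norm y)\<^sup>2\<close> with no cross term, which is exactly what
    \<open>r * x \<le> 1\<close> can absorb.\<close>
  have pointwise: "a * r * (norm (x *\<^sub>R y + u))\<^sup>2 \<le> a * (norm y)\<^sup>2 + a * (4 / 3 * C\<^sup>2)" for y
  proof -
    have "norm (x *\<^sub>R y + u) \<le> x * norm y + (1 - x) * C"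
      using u x by (intro norm_triangle_le) simp
    then have "(norm (x *\<^sub>R y + u))\<^sup>2 \<le> (x * norm y + (1 - x) * C)\<^sup>2"
      by (intro power_mono) auto
    also have "\<dots> = x * (norm y)\<^sup>2 + (1 - x) * C\<^sup>2 - x * (1 - x) * (norm y - C)\<^sup>2"
      by (simp add: power2_eq_square algebra_simps)
    also have "\<dots> \<le> x * (norm y)\<^sup>2 + 1 * C\<^sup>2"
    proof -
      have "(1 - x) * C\<^sup>2 \<le> 1 * C\<^sup>2" "0 \<le> x * (1 - x) * (norm y - C)\<^sup>2"
        using x by (simp_all add: left_diff_distrib)
      then show ?thesis by linarith
    qed
    finally have "r * (norm (x *\<^sub>R y + u))\<^sup>2 \<le> r * (x * (norm y)\<^sup>2 + C\<^sup>2)"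
      using r0 by (intro mult_left_mono) auto
    also have "\<dots> = (r * x) * (norm y)\<^sup>2 + r * C\<^sup>2" by (simp add: algebra_simps)
    also have "\<dots> \<le> 1 * (norm y)\<^sup>2 + 4 / 3 * C\<^sup>2"
      using rx r43 by (intro add_mono mult_right_mono) auto
    finally have "a * (r * (norm (x *\<^sub>R y + u))\<^sup>2) \<le> a * ((norm y)\<^sup>2 + 4 / 3 * C\<^sup>2)"
      using a by (intro mult_left_mono) auto
    then show ?thesis by (simp add: algebra_simps)
  qed
  have sq: "sqrt r ^ CARD('n) \<le> exp (a * (2 / 3 * real CARD('n) * h\<^sup>2 / lam))"
  proof -
    have "sqrt r \<le> sqrt ((exp (2 / 3 * w))\<^sup>2)"
      using r_exp by (simp add: exp_double[symmetric])
    then have "sqrt r ^ CARD('n) \<le> exp (2 / 3 * w) ^ CARD('n)"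
      using r0 by (intro power_mono) auto
    then show ?thesis by (simp add: exp_of_nat_mult[symmetric] w_def field_simps)
  qed
  have "(\<integral>\<^sup>+\<omega>. ennreal (exp (a * (norm (X t \<omega> - z))\<^sup>2)) \<partial>P)
      \<le> ennreal (sqrt (1 / (1 - 2 * a * q')) ^ DIM(real^'n))
        * (\<integral>\<^sup>+\<omega>. ennreal (exp (a / (1 - 2 * a * q') * (norm (x *\<^sub>R (X 0 \<omega> - z) + u))\<^sup>2)) \<partial>P)"
    using pos by (intro gaussian_integration_exp_bound[OF prob_space_axioms _ _ a(1) _ lin]) auto
  also have "\<dots> = ennreal (sqrt r ^ CARD('n)) * (\<integral>\<^sup>+\<omega>. ennreal (exp (a * r * (norm (x *\<^sub>R (X 0 \<omega> - z) + u))\<^sup>2)) \<partial>P)"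
    by (simp add: r_def)
  also have "\<dots> \<le> ennreal (exp (a * (2 / 3 * real CARD('n) * h\<^sup>2 / lam)))
      * (\<integral>\<^sup>+\<omega>. ennreal (exp (a * (4 / 3 * C\<^sup>2))) * ennreal (exp (a * (norm (X 0 \<omega> - z))\<^sup>2)) \<partial>P)"
  proof (intro mult_mono nn_integral_mono ennreal_leI sq)
    fix \<omega>
    have "exp (a * r * (norm (x *\<^sub>R (X 0 \<omega> - z) + u))\<^sup>2) \<le> exp (a * (4 / 3 * C\<^sup>2) + a * (norm (X 0 \<omega> - z))\<^sup>2)"
      using pointwise[of "X 0 \<omega> - z"] by simp
    then show "ennreal (exp (a * r * (norm (x *\<^sub>R (X 0 \<omega> - z) + u))\<^sup>2))
        \<le> ennreal (exp (a * (4 / 3 * C\<^sup>2))) * ennreal (exp (a * (norm (X 0 \<omega> - z))\<^sup>2))"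
      by (simp add: ennreal_mult'[symmetric] exp_add ennreal_leI)
  qed auto
  also have "\<dots> = ennreal (exp (a * (2 / 3 * real CARD('n) * h\<^sup>2 / lam)))
      * (ennreal (exp (a * (4 / 3 * C\<^sup>2))) * (\<integral>\<^sup>+\<omega>. ennreal (exp (a * (norm (X 0 \<omega> - z))\<^sup>2)) \<partial>P))"
    by (subst nn_integral_cmult) auto
  also have "\<dots> = ennreal (exp (a * (4 / 3 * C\<^sup>2 + 2 / 3 * real CARD('n) * h\<^sup>2 / lam)))
      * (\<integral>\<^sup>+\<omega>. ennreal (exp (a * (norm (X 0 \<omega> - z))\<^sup>2)) \<partial>P)"
    by (simp only: mult.assoc[symmetric] ennreal_mult'[symmetric] exp_ge_zero exp_add[symmetric] distrib_left add.commute)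
  finally show ?thesis .
qed

section \<open>The mean-field particles\<close>

text \<open>The exponential of the sum is a product, and independence of the whole paths passes to
  their values at time \<open>t\<close>.\<close>

lemma exp_moment_eq_prod:
  fixes V :: "nat \<Rightarrow> real \<Rightarrow> 'a \<Rightarrow> real^'n"
  assumes "prob_space P" and ind: "indep_processes P {0..T} {1..N} V" and t: "t \<in> {0..T}"
  shows "exp_moment P N \<kappa> z V t
    = (\<Prod>i\<in>{1..N}. \<integral>\<^sup>+\<omega>. ennreal (exp (1 / (real N * \<kappa>\<^sup>2) * (norm (V i t \<omega> - z))\<^sup>2)) \<partial>P)"
proof -
  interpret prob_space P by fact
  define a where "a = 1 / (real N * \<kappa>\<^sup>2)"
  define g where "g p = ennreal (exp (a * (norm (p t - z))\<^sup>2))" for p :: "real \<Rightarrow> real^'n"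
  have [measurable]: "(\<lambda>p. p t) \<in> (\<Pi>\<^sub>M s\<in>{0..T}. borel :: (real^'n) measure) \<rightarrow>\<^sub>M borel"
    using t by (rule measurable_component_singleton)
  have "indep_vars (\<lambda>_. borel) (\<lambda>i \<omega>. g (\<lambda>s\<in>{0..T}. V i s \<omega>)) {1..N}"
    using ind unfolding indep_processes_def
    by (rule indep_vars_compose2) (unfold g_def, measurable)
  then have indep: "indep_vars (\<lambda>_. borel) (\<lambda>i \<omega>. ennreal (exp (a * (norm (V i t \<omega> - z))\<^sup>2))) {1..N}"
    using t by (simp add: g_def)
  have "exp_moment P N \<kappa> z V t = (\<integral>\<^sup>+\<omega>. (\<Prod>i\<in>{1..N}. ennreal (exp (a * (norm (V i t \<omega> - z))\<^sup>2))) \<partial>P)"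
    unfolding exp_moment_def
    by (simp add: prod_ennreal exp_sum[symmetric] a_def sum_divide_distrib)
  also have "\<dots> = (\<Prod>i\<in>{1..N}. \<integral>\<^sup>+\<omega>. ennreal (exp (a * (norm (V i t \<omega> - z))\<^sup>2)) \<partial>P)"
    using indep by (intro indep_vars_nn_integral) auto
  finally show ?thesis by (simp add: a_def)
qed

lemma norm_proj_ball_le:
  assumes "0 < R"
  shows "norm (proj_ball vb R v - vb) \<le> R"
  using assms by (auto simp: proj_ball_def)

text \<open>The law enters the drift only through a deterministic point within \<open>2 * R\<close>
  of \<open>vstar\<close>, and truncation bounds the diffusion coefficient by
  \<open>\<sigma> * M\<close>. The one-particle estimate then applies, and the product over
  particles recovers the joint moment.\<close>

lemma mean_field_exp_moment_bound:
  fixes V :: "nat \<Rightarrow> real \<Rightarrow> 'a \<Rightarrow> real^'n"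
  assumes mf: "mean_field_copies lam \<sigma> \<alpha> R M f vb T N P F B \<rho> V"
    and pos: "0 < \<kappa>" "0 < lam" "0 < \<sigma>" "0 < R" "0 < M"
    and vb: "norm (vb - vstar) \<le> R"
    and N: "4 * \<sigma>\<^sup>2 * M\<^sup>2 / (lam * \<kappa>\<^sup>2) \<le> real N"
    and t: "t \<in> {0..T}"
  shows "exp_moment P N \<kappa> vstar V t
    \<le> ennreal (exp ((16 / 3 * R\<^sup>2 + 2 / 3 * real CARD('n) * (\<sigma> * M)\<^sup>2 / lam) / \<kappa>\<^sup>2)) * exp_moment P N \<kappa> vstar V 0"
proof -
  have fps: "filtered_prob_space P F" and ind: "indep_processes P {0..T} {1..N} V"
    using mf by (simp_all add: mean_field_copies_def iid_processes_def)
  have ps: "prob_space P" using fps by (simp add: filtered_prob_space_def)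
  define a where "a = 1 / (real N * \<kappa>\<^sup>2)"
  \<comment> \<open>Positivity of the lower bound on \<open>N\<close> excludes \<open>N = 0\<close>,
    for which \<open>a\<close> would be 0. With \<open>a\<close> as defined, that lower bound is the
    smallness condition \<open>4 * a * (\<sigma> * M)\<^sup>2 \<le> lam\<close>.\<close>
  have "0 < 4 * \<sigma>\<^sup>2 * M\<^sup>2 / (lam * \<kappa>\<^sup>2)" using pos by simp
  with N have N0: "0 < real N" by linarith
  have a: "0 < a" "4 * a * (\<sigma> * M)\<^sup>2 \<le> lam"
    using N N0 pos by (auto simp: a_def field_simps power_mult_distrib)
  define c where "c = a * (4 / 3 * (2 * R)\<^sup>2 + 2 / 3 * real CARD('n) * (\<sigma> * M)\<^sup>2 / lam)"
  define m where "m i s = (\<integral>\<^sup>+\<omega>. ennreal (exp (a * (norm (V i s \<omega> - vstar))\<^sup>2)) \<partial>P)" for i s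
  have "m i t \<le> ennreal (exp c) * m i 0" if i: "i \<in> {1..N}" for i
    unfolding m_def c_def
  proof (rule ito_linear_drift_square_exp_bound[OF fps])
    show "brownian_motion P F (B i)"
      and "ito_process P F (B i) T
        (\<lambda>t \<omega>. - lam *\<^sub>R (V i t \<omega> - proj_ball vb R (consensus_point \<alpha> f (\<rho> t))))
        (\<lambda>t \<omega>. \<sigma> * min (norm (V i t \<omega> - consensus_point \<alpha> f (\<rho> t))) M) (V i)"
      using mf i by (simp_all add: mean_field_copies_def)
    fix s \<omega>
    show "\<bar>\<sigma> * min (norm (V i s \<omega> - consensus_point \<alpha> f (\<rho> s))) M\<bar> \<le> \<sigma> * M"
      using pos by (simp add: abs_mult)
    show "norm (proj_ball vb R (consensus_point \<alpha> f (\<rho> s)) - vstar) \<le> 2 * R"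
      using norm_triangle_ineq[of "proj_ball vb R (consensus_point \<alpha> f (\<rho> s)) - vb" "vb - vstar"]
        norm_proj_ball_le[OF pos(4), of vb "consensus_point \<alpha> f (\<rho> s)"] vb by simp
  qed (use pos a t in auto)
  then have "(\<Prod>i\<in>{1..N}. m i t) \<le> (\<Prod>i\<in>{1..N}. ennreal (exp c) * m i 0)"
    by (intro prod_mono_ennreal)
  also have "\<dots> = ennreal (exp c) ^ N * (\<Prod>i\<in>{1..N}. m i 0)"
    by (simp add: prod.distrib)
  \<comment> \<open>Here \<open>real N * a = 1 / \<kappa>\<^sup>2\<close>, so the \<open>N\<close>
    equal factors combine to a constant without \<open>N\<close>.\<close>
  also have "ennreal (exp c) ^ N = ennreal (exp ((16 / 3 * R\<^sup>2 + 2 / 3 * real CARD('n) * (\<sigma> * M)\<^sup>2 / lam) / \<kappa>\<^sup>2))"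
    using N0 by (simp add: ennreal_power exp_of_nat_mult[symmetric] c_def a_def power_mult_distrib)
  finally show ?thesis
    using exp_moment_eq_prod[OF ps ind t, of \<kappa> vstar] exp_moment_eq_prod[OF ps ind, of 0 \<kappa> vstar] t
    by (simp add: m_def a_def)
qed

text \<open>Choosing \<open>K\<close> before the objective function, the number of particles and the
  probability space makes the claimed dependence of the constant precise: such data can enter only
  through the arguments of \<open>K\<close>, the last being the initial exponential moment. The
  dimension enters through the type \<open>'n\<close>.\<close>

theorem lemma8:
  shows "\<exists>K :: real \<Rightarrow> real \<Rightarrow> real \<Rightarrow> real \<Rightarrow> real \<Rightarrow> real \<Rightarrow> real \<Rightarrow> real.
    \<forall>\<kappa> lam \<sigma> \<alpha> R M \<epsilon> T (f :: real^'n \<Rightarrow> real) vstar vb N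
      (P :: 'a measure) F B \<rho> V.
      0 < \<kappa> \<longrightarrow> 0 < lam \<longrightarrow> 0 < \<sigma> \<longrightarrow> 0 < \<alpha> \<longrightarrow> 0 < R \<longrightarrow> 0 < M \<longrightarrow>
      continuous_on UNIV f \<longrightarrow>
      assumption_A1 f vstar \<longrightarrow> assumption_A2 f vstar \<longrightarrow> assumption_A3 f vstar \<longrightarrow>
      0 < \<epsilon> \<longrightarrow> \<epsilon> < (W2 (\<rho> 0) (return borel vstar))\<^sup>2 \<longrightarrow>
      T = T_star lam \<epsilon> (\<rho> 0) vstar \<longrightarrow>
      norm (vb - vstar) \<le> R \<longrightarrow>
      4 * \<sigma>\<^sup>2 * M\<^sup>2 / (lam * \<kappa>\<^sup>2) \<le> real N \<longrightarrow>
      mean_field_copies lam \<sigma> \<alpha> R M f vb T N P F B \<rho> V \<longrightarrow>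
      exp_moment P N \<kappa> vstar V 0 < \<infinity> \<longrightarrow>
      C_kappa P N \<kappa> vstar V T < \<infinity> \<and>
      C_kappa P N \<kappa> vstar V T
        \<le> ennreal (K \<kappa> lam \<sigma> R M T (enn2real (exp_moment P N \<kappa> vstar V 0)))"
proof (rule exI[of _ "\<lambda>\<kappa> lam \<sigma> R M T m.
    exp ((16 / 3 * R\<^sup>2 + 2 / 3 * real CARD('n) * (\<sigma> * M)\<^sup>2 / lam) / \<kappa>\<^sup>2) * m"], intro allI impI)
  fix \<kappa> lam \<sigma> \<alpha> R M \<epsilon> T :: real and f :: "real^'n \<Rightarrow> real" and vstar vb :: "real^'n" and N :: nat
    and P :: "'a measure" and F B \<rho> V
  assume pos: "0 < \<kappa>" "0 < lam" "0 < \<sigma>" "0 < R" "0 < M"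
    and vb: "norm (vb - vstar) \<le> R" and N: "4 * \<sigma>\<^sup>2 * M\<^sup>2 / (lam * \<kappa>\<^sup>2) \<le> real N"
    and mf: "mean_field_copies lam \<sigma> \<alpha> R M f vb T N P F B \<rho> V"
    and fin: "exp_moment P N \<kappa> vstar V 0 < \<infinity>"
  define c where "c = exp ((16 / 3 * R\<^sup>2 + 2 / 3 * real CARD('n) * (\<sigma> * M)\<^sup>2 / lam) / \<kappa>\<^sup>2)"
  have "C_kappa P N \<kappa> vstar V T \<le> ennreal c * exp_moment P N \<kappa> vstar V 0"
    unfolding C_kappa_def c_def
    by (intro SUP_least mean_field_exp_moment_bound[OF mf pos vb N])
  also have "\<dots> = ennreal (c * enn2real (exp_moment P N \<kappa> vstar V 0))"
    \<comment> \<open>Finiteness of the initial moment is what makes \<open>enn2real\<close>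
      faithful here.\<close>
    using fin by (simp add: ennreal_mult' c_def)
  finally have le: "C_kappa P N \<kappa> vstar V T \<le> ennreal (c * enn2real (exp_moment P N \<kappa> vstar V 0))" .
  also have "\<dots> < \<infinity>" by simp
  finally show "C_kappa P N \<kappa> vstar V T < \<infinity> \<and> C_kappa P N \<kappa> vstar V T
      \<le> ennreal (exp ((16 / 3 * R\<^sup>2 + 2 / 3 * real CARD('n) * (\<sigma> * M)\<^sup>2 / lam) / \<kappa>\<^sup>2)
          * enn2real (exp_moment P N \<kappa> vstar V 0))"
    using le by (simp add: c_def)
qed

end
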